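(* Let $K$ be a field and consider a set of 4 distinct skew lines $\mathcal L=\{L_1,\dots,L_4\}\subset\mathbb P^3_K$. Assume that $T$ is a transversal of multiplicity 2 for $\mathcal L$ (a priori defined over $\overline K$). Let $q$ be the point $T\cap L_4$. Then: (a) $T$ (and hence $q$) is defined over $K$ when $\mathrm{char}(K)\ne2$, or when $\mathrm{char}(K)=2$ and $|K|<\infty$. (b) If $T$ is defined over $K$, then $G_{\mathcal L}$ is (isomorphic to) a subgroup of the additive group $K$, hence abelian, and, for $p\in L_i\setminus T$, the action of $C_{\mathcal L}$ on $[p]$ is faithful (i.e., only the identity of $G_i$ takes $p$ to itself). (c) Let $p\in(\bigcup_iL_i)\setminus T$. Then $G_{\mathcal L}$, and hence $[p]$, is infinite if and only if $\mathrm{char}(K)=0$.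
   Context: For distinct $i,j,k$ let $f_{ijk}\colon L_i\to L_j$ be the linear isomorphism sending $p\in L_i$ to the point where the plane spanned by $p$ and $L_k$ meets $L_j$. The groupoid $C_{\mathcal L}$ has the lines $L_i$ as objects and all possible compositions of the maps $f_{ijk}$ as arrows. The groups $G_i=\mathrm{Hom}_{C_{\mathcal L}}(L_i,L_i)$ are all isomorphic, and $G_{\mathcal L}$ denotes any of them; it is unchanged by field extension. For $p\in L_i$, its orbit is $[p]=\bigcup_j\{g(p):g\in\mathrm{Hom}_{C_{\mathcal L}}(L_i,L_j)\}$. A transversal for $\mathcal L$ is a line meeting every line of $\mathcal L$. Three skew lines $L_i,L_j,L_k$ lie on a unique smooth quadric $Q_{ijk}$. A line $T$ is a transversal of multiplicity 2 for $\mathcal L$ if $T$ is a transversal for $\mathcal L$, no single smooth quadric contains all of the lines of $\mathcal L$, and for some three distinct indices $i_1,i_2,i_3$ each line $L_i\in\mathcal L$ is either contained in $Q_{i_1i_2i_3}$ or tangent to $Q_{i_1i_2i_3}$ at the point $L_i\cap T$. (This does not depend on the choice of the three indices.) *)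

theory Defs
  imports "HOL-Analysis.Analysis" "HOL-Algebra.Algebraic_Closure_Type"
begin

(* Projective 3-space over a field is modelled by the subspaces of 'a^4: points, lines are the
   subspaces of vector-space dimension 1, 2. A point p lies on U iff p is a subset of U, and
   two lines are disjoint iff they meet in {0} only. *)

definition proj_point :: "('a::field ^ 4) set \<Rightarrow> bool" where
  "proj_point p \<longleftrightarrow> vec.subspace p \<and> vec.dim p = 1"

definition proj_line :: "('a::field ^ 4) set \<Rightarrow> bool" where
  "proj_line M \<longleftrightarrow> vec.subspace M \<and> vec.dim M = 2"

definition points_on :: "('a::field ^ 4) set \<Rightarrow> ('a ^ 4) set set" where
  "points_on U = {p. proj_point p \<and> p \<subseteq> U}"

definition skew_lines :: "('i \<Rightarrow> ('a::field ^ 4) set) \<Rightarrow> bool" where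
  "skew_lines L \<longleftrightarrow> (\<forall>i. proj_line (L i)) \<and> (\<forall>i j. i \<noteq> j \<longrightarrow> L i \<inter> L j = {0})"


definition base_change :: "('a::field ^ 4) set \<Rightarrow> ('a alg_closure ^ 4) set" where
  "base_change U = vec.span ((\<lambda>x. \<chi> m. to_ac (x $ m)) ` U)"

definition defined_over_base :: "('a::field alg_closure ^ 4) set \<Rightarrow> bool" where
  "defined_over_base V \<longleftrightarrow> (\<exists>U :: ('a ^ 4) set. vec.subspace U \<and> V = base_change U)"


(* The map f_ijk from the points of L i to the points of L j (undefined off L i, as usual for
   extensional functions). A projectivity between lines is determined by its values on
   rational points over every field, so nothing is lost by working with maps of points. *)

definition persp ::
  "('i \<Rightarrow> ('a::field ^ 4) set) \<Rightarrow> 'i \<Rightarrow> 'i \<Rightarrow> 'i \<Rightarrow> ('a ^ 4) set \<Rightarrow> ('a ^ 4) set" where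
  "persp L i j k = (\<lambda>p \<in> points_on (L i). vec.span (p \<union> L k) \<inter> L j)"

inductive is_arrow ::
  "('i \<Rightarrow> ('a::field ^ 4) set) \<Rightarrow> 'i \<Rightarrow> 'i \<Rightarrow> (('a ^ 4) set \<Rightarrow> ('a ^ 4) set) \<Rightarrow> bool"
  for L i where
  ident: "is_arrow L i i (\<lambda>p \<in> points_on (L i). p)"
| comp: "\<lbrakk>is_arrow L i j g; j \<noteq> k; j \<noteq> l; k \<noteq> l\<rbrakk>
    \<Longrightarrow> is_arrow L i k (compose (points_on (L i)) (persp L j k l) g)"

definition arrows ::
  "('i \<Rightarrow> ('a::field ^ 4) set) \<Rightarrow> 'i \<Rightarrow> 'i \<Rightarrow> (('a ^ 4) set \<Rightarrow> ('a ^ 4) set) set" where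
  "arrows L i j = {g. is_arrow L i j g}"

definition vertex_group ::
  "('i \<Rightarrow> ('a::field ^ 4) set) \<Rightarrow> 'i \<Rightarrow> (('a ^ 4) set \<Rightarrow> ('a ^ 4) set) monoid" where
  "vertex_group L i =
    \<lparr>carrier = arrows L i i,
     monoid.mult = (\<lambda>g h. compose (points_on (L i)) g h),
     one = (\<lambda>p \<in> points_on (L i). p)\<rparr>"

definition groupoid_orbit ::
  "('i \<Rightarrow> ('a::field ^ 4) set) \<Rightarrow> 'i \<Rightarrow> ('a ^ 4) set \<Rightarrow> ('a ^ 4) set set" where
  "groupoid_orbit L i p = (\<Union>j. {g p | g. g \<in> arrows L i j})"

definition acts_faithfully_at ::
  "('i \<Rightarrow> ('a::field ^ 4) set) \<Rightarrow> 'i \<Rightarrow> ('a ^ 4) set \<Rightarrow> bool" where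
  "acts_faithfully_at L i p \<longleftrightarrow>
    (\<forall>g \<in> carrier (vertex_group L i). g p = p \<longrightarrow> g = \<one>\<^bsub>vertex_group L i\<^esub>)"


(* A quadratic form is given by an arbitrary coefficient matrix, A $ m $ n being a
   coefficient of x_m x_n; A need not be symmetric, so that every quadratic form arises also in
   characteristic 2. Accordingly the partial derivatives involve A + transpose A. *)

definition quad_form :: "'a::field ^ 4 ^ 4 \<Rightarrow> 'a ^ 4 \<Rightarrow> 'a" where
  "quad_form A x = (\<Sum>m\<in>UNIV. \<Sum>n\<in>UNIV. A $ m $ n * x $ m * x $ n)"

definition quad_grad :: "'a::field ^ 4 ^ 4 \<Rightarrow> 'a ^ 4 \<Rightarrow> 'a ^ 4" where
  "quad_grad A x = (\<chi> n. \<Sum>m\<in>UNIV. (A $ m $ n + A $ n $ m) * x $ m)"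

definition quadric :: "'a::field ^ 4 ^ 4 \<Rightarrow> ('a ^ 4) set" where
  "quadric A = {x. quad_form A x = 0}"

(* Jacobian criterion; the field is algebraically closed, so rational points suffice. *)
definition smooth_quadric :: "'a::alg_closed_field ^ 4 ^ 4 \<Rightarrow> bool" where
  "smooth_quadric A \<longleftrightarrow> (\<forall>x. x \<noteq> 0 \<longrightarrow> \<not> (quad_form A x = 0 \<and> quad_grad A x = 0))"

(* M passes through the point p of the quadric and lies in the tangent plane there. *)
definition tangent_at ::
  "'a::alg_closed_field ^ 4 ^ 4 \<Rightarrow> ('a ^ 4) set \<Rightarrow> ('a ^ 4) set \<Rightarrow> bool" where
  "tangent_at A M p \<longleftrightarrow> proj_point p \<and> p \<subseteq> M \<and> p \<subseteq> quadric A \<and>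
    (\<forall>x\<in>p. \<forall>y\<in>M. (\<Sum>n\<in>UNIV. quad_grad A x $ n * y $ n) = 0)"


definition transversal :: "('i \<Rightarrow> ('a::field ^ 4) set) \<Rightarrow> ('a ^ 4) set \<Rightarrow> bool" where
  "transversal L T \<longleftrightarrow> proj_line T \<and> (\<forall>i. T \<inter> L i \<noteq> {0})"

(* For skew lines, the smooth quadric through L i1, L i2, L i3 exists and is unique, so the
   existential quantifier over A below just names it. *)
definition transversal_mult2 ::
  "('i \<Rightarrow> ('a::alg_closed_field ^ 4) set) \<Rightarrow> ('a ^ 4) set \<Rightarrow> bool" where
  "transversal_mult2 L T \<longleftrightarrow>
    transversal L T \<and>
    \<not> (\<exists>A. smooth_quadric A \<and> (\<forall>i. L i \<subseteq> quadric A)) \<and>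
    (\<exists>i1 i2 i3. i1 \<noteq> i2 \<and> i1 \<noteq> i3 \<and> i2 \<noteq> i3 \<and>
      (\<exists>A. smooth_quadric A \<and>
        L i1 \<subseteq> quadric A \<and> L i2 \<subseteq> quadric A \<and> L i3 \<subseteq> quadric A \<and>
        (\<forall>i. L i \<subseteq> quadric A \<or> tangent_at A (L i) (L i \<inter> T))))"

definition embeds_in_additive_group :: "('b, 'c) monoid_scheme \<Rightarrow> 'a::field itself \<Rightarrow> bool" where
  "embeds_in_additive_group G _ \<longleftrightarrow>
    (\<exists>H. subgroup H (add_monoid (ring_of_type_algebra :: 'a ring)) \<and>
         G \<cong> (add_monoid (ring_of_type_algebra :: 'a ring))\<lparr>carrier := H\<rparr>)"

end

theory Submission
  imports Defs
begin

text \<open>Three of the lines give coordinates on $V = K^2 \oplus K^2$ in which they are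
  $K^2 \oplus 0$, $0 \oplus K^2$ and the diagonal; the fourth is the graph of a matrix $M$.
  A transversal is an eigenvector of $M$, and multiplicity 2 means that
  $M = \mu + \varepsilon$ with $\varepsilon^2 = 0$, $\varepsilon \neq 0$. So $V$ is the square
  of the ring $R = K[\varepsilon]$ of dual numbers, the lines are free $R$-submodules $R e_i$ of
  rank one, and $T \cap L_i = \varepsilon R e_i$. All perspectivities are $R$-linear, hence are
  given by units of $R$; on points they act through $R^* / K^* \cong (K, +)$, which acts on the
  points of $L_i \setminus T$ by translations. A cross ratio of the lines gives a nontrivial
  translation, and the group is finitely generated, so it is infinite precisely in characteristic 0.

  Over $K$ this applies as soon as $\mu \in K$, which is equivalent to $T$ being defined over
  $K$; since $2 \mu$ and $\mu^2$ are the trace and the determinant of $M$, this is automatic in (a).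
  Otherwise the characteristic is 2, and base change embeds the groupoid over $K$ into the finite
  one over the algebraic closure.\<close>

section \<open>Lines in projective space\<close>

text \<open>Skewness makes the determinants [jk] of e_j and e_k units of R, so V is the direct sum
  of R e_j and R e_k, and the perspectivity from L_i to L_j is projection along R e_k; this is the
  source of R-linearity. In adapted coordinates the four vectors are (1, 0), (0, 1), (1, 1), (1,
  \<mu> + \<epsilon>), and \<mu> differs from 0 and 1 because L_4 is skew to L_1 and L_3. The loop
  from L_1 to L_2 with centre L_3 and back with centre L_4 multiplies by 1 / (\<mu> + \<epsilon>),
  which is translation by -1 / \<mu>.

  The obstacle is that \<mu> a priori lies only in the algebraic closure. Being a double root of a
  quadratic polynomial over K, it is purely inseparable of degree at most 2, hence outside K only
  over an imperfect field of characteristic 2. The coordinates are therefore a locale over an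
  arbitrary field: it is available over the closure in every case, and over K when \<mu> is in K. In
  the remaining case the characteristic is positive, and only finiteness has to descend to
  K.\<close>

definition indep2 :: "'a::field ^ 'n \<Rightarrow> 'a ^ 'n \<Rightarrow> bool" where
  "indep2 x y \<longleftrightarrow> (\<forall>c d. c *s x + d *s y = 0 \<longrightarrow> c = 0 \<and> d = 0)"

definition indep4 :: "'a::field ^ 'n \<Rightarrow> 'a ^ 'n \<Rightarrow> 'a ^ 'n \<Rightarrow> 'a ^ 'n \<Rightarrow> bool" where
  "indep4 x y z u \<longleftrightarrow>
    (\<forall>c d e f. c *s x + d *s y + e *s z + f *s u = 0 \<longrightarrow> c = 0 \<and> d = 0 \<and> e = 0 \<and> f = 0)"

lemma span_1: "vec.span {x :: 'a::field ^ 'n} = range (\<lambda>c. c *s x)"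
  by (rule vec.span_singleton)

lemma span_2: "vec.span {x, y :: 'a::field ^ 'n} = {c *s x + d *s y | c d. True}" (is "?A = ?B")
proof
  show "?A \<subseteq> ?B"
  proof
    fix v assume "v \<in> ?A"
    then obtain c where "v - c *s x \<in> vec.span {y}" by (auto simp: vec.span_insert[of x])
    then obtain d where "v - c *s x = d *s y" by (auto simp: span_1)
    then have "v = c *s x + d *s y" by (simp add: algebra_simps)
    then show "v \<in> ?B" by blast
  qed
  show "?B \<subseteq> ?A"
    by (intro subsetI, elim CollectE exE conjE, hypsubst,
        intro vec.span_add vec.span_scale vec.span_base) simp_all
qed

lemma span_4: "vec.span {x, y, z, u :: 'a::field ^ 'n} =
    {c *s x + d *s y + e *s z + f *s u | c d e f. True}" (is "?A = ?B")
proof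
  show "?A \<subseteq> ?B"
  proof
    fix v assume "v \<in> ?A"
    then obtain c d where "v - c *s x - d *s y \<in> vec.span {z, u}"
      by (auto simp: vec.span_insert[of x] vec.span_insert[of y])
    then obtain e f where "v - c *s x - d *s y = e *s z + f *s u"
      by (auto simp: span_2)
    then have "v = c *s x + d *s y + e *s z + f *s u" by (simp add: algebra_simps)
    then show "v \<in> ?B" by blast
  qed
  show "?B \<subseteq> ?A"
    by (intro subsetI, elim CollectE exE conjE, hypsubst,
        intro vec.span_add vec.span_scale vec.span_base) simp_all
qed

lemma indep2_independent:
  assumes "indep2 x y" shows "x \<noteq> y" "vec.independent {x, y}"
proof -
  show "x \<noteq> y"
    using assms[unfolded indep2_def, rule_format, of 1 "-1"] by auto
  have "y \<noteq> 0" using assms[unfolded indep2_def, rule_format, of 0 1] by auto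
  moreover have "x \<notin> vec.span {y}"
  proof
    assume "x \<in> vec.span {y}"
    then obtain c where "x = c *s y" by (auto simp: span_1)
    then show False using assms[unfolded indep2_def, rule_format, of 1 "-c"] by auto
  qed
  ultimately show "vec.independent {x, y}"
    by (simp add: vec.independent_insert)
qed

lemma indep2_iff: "indep2 x y \<longleftrightarrow> x \<noteq> y \<and> vec.independent {x, y}"
proof
  assume *: "x \<noteq> y \<and> vec.independent {x, y}"
  then have x: "x \<notin> vec.span {y}" and y: "y \<noteq> 0"
    by (auto simp: vec.independent_insert)
  show "indep2 x y"
    unfolding indep2_def
  proof (intro allI impI)
    fix c d assume eq: "c *s x + d *s y = 0"
    have "c = 0"
    proof (rule ccontr)
      assume "c \<noteq> 0"
      moreover have "c *s x = (- d) *s y" using eq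
        by (simp add: add_eq_0_iff2)
      ultimately have "x = (inverse c * - d) *s y"
        by (metis vector_ssub_ldistrib vec.scale_scale vec.scale_one left_inverse)
      with x show False by (metis rangeI span_1)
    qed
    with eq y show "c = 0 \<and> d = 0" by simp
  qed
qed (use indep2_independent in blast)

lemma proj_line_span2:
  assumes "proj_line (M :: ('a::field ^ 4) set)"
  obtains x y where "indep2 x y" "M = vec.span {x, y}"
proof -
  obtain B where B: "B \<subseteq> M" "vec.independent B" "M \<subseteq> vec.span B" "card B = vec.dim M"
    using vec.basis_exists by blast
  then have "card B = 2" using assms by (simp add: proj_line_def)
  then obtain x y where xy: "B = {x, y}" "x \<noteq> y" by (meson card_2_iff)
  have "M = vec.span B"
    using B assms vec.span_minimal[of B M] by (auto simp: proj_line_def)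
  then show thesis using that B xy by (auto simp: indep2_iff)
qed

lemma span2_proj_line:
  assumes "indep2 x y" shows "proj_line (vec.span {x, y :: 'a::field ^ 4})"
  using assms by (simp add: proj_line_def indep2_iff vec.dim_span_eq_card_independent del: vec.dim_span)

lemma proj_line_eq_span2:
  assumes "proj_line (M :: ('a::field ^ 4) set)" "x \<in> M" "y \<in> M" "indep2 x y"
  shows "M = vec.span {x, y}"
proof -
  have "{x, y} \<subseteq> M" using assms by simp
  then have "vec.span {x, y} \<subseteq> M"
    using assms(1) unfolding proj_line_def by (blast intro: vec.span_minimal[THEN subsetD])
  moreover have "vec.dim (vec.span {x, y}) = 2"
    using span2_proj_line[OF assms(4)] unfolding proj_line_def by blast
  ultimately show ?thesis
    using assms(1) vec.subspace_dim_equal[of "vec.span {x, y}" M]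
    unfolding proj_line_def by (metis order_refl vec.subspace_span)
qed

lemma proj_point_iff:
  "proj_point (p :: ('a::field ^ 4) set) \<longleftrightarrow> (\<exists>x. x \<noteq> 0 \<and> p = vec.span {x})"
proof
  assume p: "proj_point p"
  obtain B where B: "B \<subseteq> p" "vec.independent B" "p \<subseteq> vec.span B" "card B = vec.dim p"
    using vec.basis_exists by blast
  then have "card B = 1" using p by (simp add: proj_point_def)
  then obtain x where x: "B = {x}" by (auto simp: card_1_singleton_iff)
  have "p = vec.span B"
    using B p vec.span_minimal[of B p] by (auto simp: proj_point_def)
  then show "\<exists>x. x \<noteq> 0 \<and> p = vec.span {x}"
    using B x by (intro exI[of _ x]) auto
qed (auto simp: proj_point_def)

lemma indep4_span_UNIV:
  assumes "indep4 x y z (u :: 'a::field ^ 4)"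
  shows "vec.span {x, y, z, u} = UNIV"
proof -
  have ne: "x \<notin> vec.span {y, z, u}" "y \<notin> vec.span {z, u}" "z \<notin> vec.span {u}" "u \<noteq> 0"
  proof -
    show "u \<noteq> 0" using assms[unfolded indep4_def, rule_format, of 0 0 0 1] by auto
    show "z \<notin> vec.span {u}"
    proof
      assume "z \<in> vec.span {u}"
      then obtain f where "z = f *s u" by (auto simp: span_1)
      then show False using assms[unfolded indep4_def, rule_format, of 0 0 1 "-f"] by auto
    qed
    show "y \<notin> vec.span {z, u}"
    proof
      assume "y \<in> vec.span {z, u}"
      then obtain e f where "y = e *s z + f *s u" by (auto simp: span_2)
      then show False using assms[unfolded indep4_def, rule_format, of 0 1 "-e" "-f"] by auto
    qed
    show "x \<notin> vec.span {y, z, u}"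
    proof
      assume "x \<in> vec.span {y, z, u}"
      then obtain d where "x - d *s y \<in> vec.span {z, u}" by (auto simp: vec.span_insert[of y])
      then obtain e f where "x - d *s y = e *s z + f *s u" by (auto simp: span_2)
      then have "x = d *s y + e *s z + f *s u" by (simp add: algebra_simps)
      then show False
        using assms[unfolded indep4_def, rule_format, of 1 "-d" "-e" "-f"] by auto
    qed
  qed
  have i: "vec.independent {x, y, z, u}"
    using ne by (simp add: vec.independent_insert)
  have "x \<noteq> y" "x \<noteq> z" "x \<noteq> u" "y \<noteq> z" "y \<noteq> u" "z \<noteq> u"
    using ne by (auto intro: vec.span_base)
  then have "card {x, y, z, u} = 4" by simp
  then have "vec.dim (vec.span {x, y, z, u}) = 4"
    using i by (simp add: vec.dim_span_eq_card_independent del: vec.dim_span)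
  then show ?thesis
    using vec.subspace_dim_equal[of "vec.span {x, y, z, u}" UNIV] vec_dim_card[where 'a = 'a and 'n = 4]
    by (simp del: vec.dim_UNIV vec.dim_span)
qed

lemma span_UNIV_indep4:
  assumes "vec.span {x, y, z, u :: 'a::field ^ 4} = UNIV"
  shows "indep4 x y z u"
proof -
  let ?B = "{x, y, z, u}"
  have "card ?B \<le> 4" by (simp add: card_insert_if)
  moreover have "vec.dim (UNIV :: ('a ^ 4) set) = 4" by (simp add: vec_dim_card del: vec.dim_UNIV)
  ultimately have i: "vec.independent ?B"
    using assms by (intro vec.card_le_dim_spanning[of _ UNIV]) auto
  have "card ?B = 4"
    using i assms vec.dim_span_eq_card_independent[OF i] vec_dim_card[where 'a = 'a and 'n = 4]
    by (simp del: vec.dim_UNIV)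
  then have d: "x \<noteq> y" "x \<noteq> z" "x \<noteq> u" "y \<noteq> z" "y \<noteq> u" "z \<noteq> u"
    by (auto simp: card_insert_if split: if_splits)
  show ?thesis
    unfolding indep4_def
  proof (intro allI impI)
    fix c d e f assume eq: "c *s x + d *s y + e *s z + f *s u = 0"
    define w where "w = (\<lambda>v. if v = x then c else if v = y then d else if v = z then e else f)"
    have "(\<Sum>v\<in>?B. w v *s v) = 0"
      using d eq by (simp add: w_def add.assoc)
    then have "\<forall>v\<in>?B. w v = 0"
      using vec.independentD[OF i, of ?B w] by blast
    then show "c = 0 \<and> d = 0 \<and> e = 0 \<and> f = 0"
      using d by (auto simp: w_def split: if_splits)
  qed
qed

section \<open>Computing a perspectivity by splitting a vector\<close>

text \<open>Since y = x - (x - y), the vector y lies in the plane through x and \<open>L k\<close>.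
  Any other vector of this plane on \<open>L j\<close> differs from a multiple of y by an element of
  the trivial intersection of \<open>L j\<close> and \<open>L k\<close>. All perspectivities below
  are computed from such a splitting of x.\<close>

lemma persp_span:
  assumes sub: "\<And>j. vec.subspace (L j)" and "L j \<inter> L k = {0}"
    "x \<in> L i" "x \<noteq> 0" "y \<in> L j" "x - y \<in> L k"
  shows "persp L i j k (vec.span {x :: 'a::field ^ 4}) = vec.span {y}"
proof -
  have "vec.span {x} \<in> points_on (L i)"
    using assms vec.span_minimal[of "{x}" "L i"] by (auto simp: points_on_def proj_point_iff)
  then have "persp L i j k (vec.span {x}) = vec.span (vec.span {x} \<union> L k) \<inter> L j"
    by (simp add: persp_def)
  also have "vec.span (vec.span {x} \<union> L k) = vec.span ({x} \<union> L k)"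
    by (simp only: vec.span_Un vec.span_span)
  also have "\<dots> \<inter> L j = vec.span {y}"
  proof (intro subset_antisym subsetI)
    fix v assume "v \<in> vec.span ({x} \<union> L k) \<inter> L j"
    then have "v \<in> vec.span (insert x (L k))" and v: "v \<in> L j" by simp_all
    then obtain c where "v - c *s x \<in> vec.span (L k)"
      unfolding vec.span_insert by blast
    then have "v - c *s x \<in> L k" using vec.span_eq_iff[THEN iffD2, OF sub] by simp
    moreover have "c *s (x - y) \<in> L k" by (intro vec.subspace_scale sub assms)
    ultimately have "(v - c *s x) + c *s (x - y) \<in> L k"
      by (intro vec.subspace_add sub)
    then have "v - c *s y \<in> L k" by (simp add: algebra_simps)
    moreover have "v - c *s y \<in> L j"
      using v assms by (simp add: vec.subspace_diff vec.subspace_scale)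
    ultimately have "v - c *s y = 0" using assms(2) by blast
    then show "v \<in> vec.span {y}" by (auto simp: span_1)
  next
    fix v assume "v \<in> vec.span {y}"
    then obtain c where v: "v = c *s y" by (auto simp: span_1)
    have "x \<in> vec.span ({x} \<union> L k)" "x - y \<in> vec.span ({x} \<union> L k)"
      using assms(6) by (auto intro: vec.span_base)
    then have "x - (x - y) \<in> vec.span ({x} \<union> L k)" by (rule vec.span_diff)
    then have "y \<in> vec.span ({x} \<union> L k)" by simp
    then show "v \<in> vec.span ({x} \<union> L k) \<inter> L j"
      using v assms(5) by (simp add: vec.span_scale vec.subspace_scale[OF sub])
  qed
  finally show ?thesis .
qed

lemma indep4_eq_iff:
  assumes "indep4 x y z u"
  shows "c *s x + d *s y + e *s z + f *s u = c' *s x + d' *s y + e' *s z + f' *s u \<longleftrightarrow>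
    c = c' \<and> d = d' \<and> e = e' \<and> f = f'"
proof
  assume "c *s x + d *s y + e *s z + f *s u = c' *s x + d' *s y + e' *s z + f' *s u"
  then have "(c - c') *s x + (d - d') *s y + (e - e') *s z + (f - f') *s u = 0"
    by (simp add: vec.scale_left_diff_distrib algebra_simps)
  then show "c = c' \<and> d = d' \<and> e = e' \<and> f = f'"
    using assms unfolding indep4_def by fastforce
qed simp

lemma span_scale_1:
  assumes "c \<noteq> 0" shows "vec.span {c *s x} = vec.span {x :: 'a::field ^ 'n}"
proof -
  have "d *s x \<in> range (\<lambda>e. e *s (c *s x))" for d
    using assms by (intro image_eqI[of _ _ "d / c"]) auto
  then show ?thesis by (auto simp: span_1)
qed

text \<open>Generators are adjoined one at a time: in characteristic p the multiples of x are those
  by 0, ..., p - 1, so finitely many translates of H suffice. This is the finiteness of a finitely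
  generated additive group in positive characteristic.\<close>

lemma finite_additive_closure:
  fixes B :: "'a::field set"
  assumes "finite B" "CHAR('a) \<noteq> 0"
  obtains H where "finite H" "B \<subseteq> H" "0 \<in> H" "\<And>x y. x \<in> H \<Longrightarrow> y \<in> H \<Longrightarrow> x + y \<in> H"
proof -
  have "\<exists>H. finite H \<and> B \<subseteq> H \<and> 0 \<in> H \<and> (\<forall>x\<in>H. \<forall>y\<in>H. x + y \<in> H)"
    using assms(1)
  proof induction
    case empty
    show ?case by (intro exI[of _ "{0}"]) auto
  next
    case (insert x B)
    then obtain H where H: "finite H" "B \<subseteq> H" "0 \<in> H" "\<And>x y. x \<in> H \<Longrightarrow> y \<in> H \<Longrightarrow> x + y \<in> H"
      by blast
    define p where "p = CHAR('a)"
    have p: "p > 0" "of_nat p = (0 :: 'a)" using assms(2) by (auto simp: p_def)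
    have md: "(of_nat (n mod p) :: 'a) = of_nat n" for n
      using p(2) by (metis add_0 mod_mult_div_eq mult_zero_left of_nat_add of_nat_mult add.commute)
    define H' where "H' = (\<lambda>(h, n). h + of_nat n * x) ` (H \<times> {..<p})"
    have mem: "h + of_nat n * x \<in> H'" if "h \<in> H" for h n
      unfolding H'_def using that p(1) md[of n]
      by (intro image_eqI[of _ _ "(h, n mod p)"]) auto
    have "finite H'" using H by (simp add: H'_def)
    moreover have "h \<in> H'" if "h \<in> H" for h using mem[OF that, of 0] by simp
    moreover have "x \<in> H'" using mem[OF H(3), of 1] by simp
    moreover have "y + z \<in> H'" if yz: "y \<in> H'" "z \<in> H'" for y z
    proof -
      obtain h m g n where "y = h + of_nat m * x" "z = g + of_nat n * x" "h \<in> H" "g \<in> H"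
        using yz by (auto simp: H'_def)
      then show ?thesis using mem[of "h + g" "m + n"] H(4) by (simp add: algebra_simps)
    qed
    ultimately show ?case using H(2,3) by (intro exI[of _ H']) auto
  qed
  then show thesis using that by blast
qed

section \<open>Lines over the dual numbers\<close>

text \<open>The R-basis of V is \<open>a'\<close>, \<open>b'\<close>, with \<open>a\<close> =
  \<epsilon> \<open>a'\<close> and \<open>b\<close> = \<epsilon> \<open>b'\<close>; the two vectors
  spanning \<open>L i\<close> are e_i and \<epsilon> e_i for e_i = (p_i, r_i + \<epsilon> s_i). The
  condition \<open>cross\<close> says that the determinants [ij] are units. The expression in
  \<open>cross_ratio\<close> is the \<epsilon>-coefficient of [i1 i3] [i2 i4] / ([i2 i3] [i1 i4])
  divided by its constant term.\<close>

locale nilpotent_frame =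
  fixes L :: "'i::finite \<Rightarrow> ('a::field ^ 4) set"
    and a a' b b' :: "'a ^ 4" and p r s :: "'i \<Rightarrow> 'a" and i1 i2 i3 i4 :: 'i
  assumes indep: "indep4 a a' b b'"
    and L_eq: "\<And>i. L i = vec.span {p i *s a' + r i *s b' + s i *s b, p i *s a + r i *s b}"
    and cross: "\<And>i j. i \<noteq> j \<Longrightarrow> p i * r j - p j * r i \<noteq> 0"
    and distinct: "distinct [i1, i2, i3, i4]"
    and cross_ratio: "(p i1 * s i3 - p i3 * s i1) / (p i1 * r i3 - p i3 * r i1)
      - (p i2 * s i3 - p i3 * s i2) / (p i2 * r i3 - p i3 * r i2)
      + (p i2 * s i4 - p i4 * s i2) / (p i2 * r i4 - p i4 * r i2)
      - (p i1 * s i4 - p i4 * s i1) / (p i1 * r i4 - p i4 * r i1) \<noteq> 0"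
begin

definition v where "v i = p i *s a' + r i *s b' + s i *s b"
definition w where "w i = p i *s a + r i *s b"
definition D where "D i j = p i * r j - p j * r i"
definition E where "E i j = p i * s j - p j * s i"
text \<open>With [ij] = \<open>D i j\<close> + \<epsilon> \<open>E i j\<close>, the coefficient [ik]
  / [jk] in Cramer's rule equals (\<open>D i k\<close> / \<open>D j k\<close>) (1 + \<epsilon>
  \<open>\<tau> i j k\<close>): \<open>\<tau>\<close> is a logarithmic derivative, so products of
  units become sums.\<close>

definition \<tau> where "\<tau> i j k = E i k / D i k - E j k / D j k"
text \<open>The point \<open>pt i t\<close> is spanned by (1 + \<epsilon> t) e_i, so t is an affine
  coordinate on the line with \<open>inf_pt i\<close> removed; the latter is spanned by \<epsilon>
  e_i.\<close>

definition pt where "pt i t = vec.span {v i + t *s w i}"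
definition inf_pt where "inf_pt i = vec.span {w i}"

lemma L_span: "L i = vec.span {v i, w i}"
  using L_eq by (simp add: v_def w_def)

lemma D_nz: "i \<noteq> j \<Longrightarrow> D i j \<noteq> 0"
  using cross by (simp add: D_def)

lemma pr_nz: "p i \<noteq> 0 \<or> r i \<noteq> 0"
proof -
  obtain j where "j \<noteq> i" using distinct by (metis distinct_length_2_or_more)
  then show ?thesis using D_nz[of i j] by (auto simp: D_def)
qed

lemma vw_coord: "c *s v i + e *s w i =
    (e * p i) *s a + (c * p i) *s a' + (c * s i + e * r i) *s b + (c * r i) *s b'"
  by (simp add: v_def w_def vec.scale_right_distrib vec.scale_left_distrib algebra_simps)

lemma vw_eq_iff: "c *s v i + e *s w i = c' *s v i + e' *s w i \<longleftrightarrow> c = c' \<and> e = e'"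
  unfolding vw_coord indep4_eq_iff[OF indep] using pr_nz[of i] by auto

lemma vw_nz: "c *s v i + e *s w i = 0 \<longleftrightarrow> c = 0 \<and> e = 0"
  using vw_eq_iff[of c i e 0 0] by simp

lemma vtw_nz: "v i + t *s w i \<noteq> 0"
  using vw_nz[of 1 i t] by simp

lemma w_nz: "w i \<noteq> 0"
  using vw_nz[of 0 i 1] by simp

lemma subspace_L: "vec.subspace (L i)"
  by (simp add: L_span)

lemma L_mem: "c *s v i + e *s w i \<in> L i"
  by (auto simp: L_span span_2)

lemma L_memE:
  assumes "x \<in> L i" obtains c e where "x = c *s v i + e *s w i"
  using assms by (auto simp: L_span span_2)

lemma skew: assumes "i \<noteq> j" shows "L i \<inter> L j = {0}"
proof -
  have "x = 0" if x: "x \<in> L i" "x \<in> L j" for x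
  proof -
    obtain c e c' e' where *: "x = c *s v i + e *s w i" "x = c' *s v j + e' *s w j"
      using x by (metis L_memE)
    have eqs: "e * p i = e' * p j" "c * p i = c' * p j" "c * r i = c' * r j"
      "c * s i + e * r i = c' * s j + e' * r j"
      using trans[OF *(1)[symmetric] *(2)] unfolding vw_coord indep4_eq_iff[OF indep] by auto
    have "c * D i j = (c * p i) * r j - (c * r i) * p j" by (simp add: D_def algebra_simps)
    also have "\<dots> = 0" unfolding eqs by simp
    finally have c: "c = 0" using D_nz[OF assms] by simp
    have "c' * D i j = p i * (c' * r j) - (c' * p j) * r i" by (simp add: D_def algebra_simps)
    also have "\<dots> = 0" unfolding eqs[symmetric] by simp
    finally have c': "c' = 0" using D_nz[OF assms] by simp
    have "e * r i = e' * r j" using eqs(4) c c' by simp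
    have "e * D i j = (e * p i) * r j - (e * r i) * p j" by (simp add: D_def algebra_simps)
    also have "\<dots> = 0" unfolding eqs(1) \<open>e * r i = e' * r j\<close> by simp
    finally have "e = 0" using D_nz[OF assms] by simp
    then show "x = 0" using c *(1) by simp
  qed
  then show ?thesis using vec.subspace_0[OF subspace_L] by blast
qed

lemma points_on_L: "points_on (L i) = insert (inf_pt i) (range (pt i))"
proof (intro subset_antisym subsetI)
  fix q assume "q \<in> points_on (L i)"
  then obtain x where x: "x \<noteq> 0" "q = vec.span {x}" "q \<subseteq> L i"
    by (auto simp: points_on_def proj_point_iff)
  then have "x \<in> L i" using vec.span_base by blast
  then obtain c e where ce: "x = c *s v i + e *s w i" by (rule L_memE)
  show "q \<in> insert (inf_pt i) (range (pt i))"
  proof (cases "c = 0")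
    case True
    then have "q = inf_pt i"
      using x ce span_scale_1[of e "w i"] by (auto simp: inf_pt_def)
    then show ?thesis by simp
  next
    case False
    then have eq: "x = c *s (v i + (e / c) *s w i)"
      using ce by (simp add: vec.scale_right_distrib)
    have "q = pt i (e / c)"
      unfolding x(2) eq pt_def by (rule span_scale_1[OF False])
    then show ?thesis by simp
  qed
next
  fix q assume "q \<in> insert (inf_pt i) (range (pt i))"
  moreover have "inf_pt i \<in> points_on (L i)"
    using w_nz[of i] vec.span_minimal[of "{w i}" "L i"] L_mem[of 0 i 1] subspace_L
    by (auto simp: points_on_def proj_point_iff inf_pt_def)
  moreover have "pt i t \<in> points_on (L i)" for t
    using vtw_nz[of i t] vec.span_minimal[of "{v i + t *s w i}" "L i"] L_mem[of 1 i t] subspace_L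
    by (auto simp: points_on_def proj_point_iff pt_def)
  ultimately show "q \<in> points_on (L i)" by blast
qed

lemma pt_mem: "pt i t \<in> points_on (L i)" and inf_pt_mem: "inf_pt i \<in> points_on (L i)"
  by (auto simp: points_on_L)

lemma pt_eq_iff [simp]: "pt i t = pt i u \<longleftrightarrow> t = u"
proof
  assume "pt i t = pt i u"
  then have "v i + t *s w i \<in> vec.span {v i + u *s w i}"
    unfolding pt_def using vec.span_base by blast
  then obtain c where "v i + t *s w i = c *s (v i + u *s w i)" by (auto simp: span_1)
  then have "1 *s v i + t *s w i = c *s v i + (c * u) *s w i"
    by (simp add: vec.scale_right_distrib)
  then show "t = u" unfolding vw_eq_iff by auto
qed simp

lemma pt_neq_inf_pt [simp]: "pt i t \<noteq> inf_pt i"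
proof
  assume "pt i t = inf_pt i"
  then have "v i + t *s w i \<in> vec.span {w i}"
    unfolding pt_def inf_pt_def using vec.span_base by blast
  then obtain c where "v i + t *s w i = c *s w i" by (auto simp: span_1)
  then have "1 *s v i + t *s w i = 0 *s v i + c *s w i" by simp
  then show False unfolding vw_eq_iff by simp
qed

text \<open>Identifying \<open>v i\<close> and \<open>w i\<close> with $e_i$ and $\varepsilon e_i$, where
  $e_i = (p_i, r_i + \varepsilon s_i)$ in the square of the dual numbers, this is
  Cramer's rule $e_i = ([ik]/[jk]) e_j + ([ij]/[kj]) e_k$ multiplied by $1 + \varepsilon t$.\<close>
lemma decompose:
  assumes "i \<noteq> j" "i \<noteq> k" "j \<noteq> k"
  shows "v i + t *s w i = (D i k / D j k) *s (v j + (t + \<tau> i j k) *s w j)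
    + (D i j / D k j) *s (v k + (t + \<tau> i k j) *s w k)"
proof -
  define \<alpha> \<gamma> where "\<alpha> = D i k / D j k" and "\<gamma> = D i j / D k j"
  have anti: "D k j = - D j k" "E k j = - E j k" by (simp_all add: D_def E_def)
  have nz: "D i k \<noteq> 0" "D i j \<noteq> 0" "D j k \<noteq> 0" using assms D_nz by auto
  have at: "\<alpha> * \<tau> i j k = (E i k * D j k - D i k * E j k) / (D j k * D j k)"
    using nz by (simp add: \<alpha>_def \<tau>_def field_simps)
  have gt: "\<gamma> * \<tau> i k j = (D i j * E j k - E i j * D j k) / (D j k * D j k)"
    using nz by (simp add: \<gamma>_def \<tau>_def anti field_simps)
  \<comment> \<open>\<open>e1\<close> and \<open>e2\<close> are Cramer's rule modulo \<epsilon>;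
    \<open>e3\<close> and \<open>e4\<close> compare the \<epsilon>-coefficients of the two
    coordinates. The sum in \<open>e3\<close> vanishes because the first coordinate of each e_i is
    free of \<epsilon>.\<close>
  have e1: "p i = \<alpha> * p j + \<gamma> * p k" and e2: "r i = \<alpha> * r j + \<gamma> * r k"
    using nz by (simp_all add: \<alpha>_def \<gamma>_def anti field_simps) (simp_all add: D_def algebra_simps)
  have e3: "(\<alpha> * \<tau> i j k) * p j + (\<gamma> * \<tau> i k j) * p k = 0"
    unfolding at gt using nz
    by (simp add: field_simps) (simp add: D_def E_def algebra_simps)
  have e4: "s i = \<alpha> * s j + \<gamma> * s k + (\<alpha> * \<tau> i j k) * r j + (\<gamma> * \<tau> i k j) * r k"
  proof -
    have "\<alpha> * s j + \<gamma> * s k = (D i k * D j k * s j - D i j * D j k * s k) / (D j k * D j k)"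
      using nz by (simp add: \<alpha>_def \<gamma>_def anti field_simps)
    moreover have "s i = ((D i k * D j k * s j - D i j * D j k * s k)
        + (E i k * D j k - D i k * E j k) * r j + (D i j * E j k - E i j * D j k) * r k) / (D j k * D j k)"
      using nz by (simp add: eq_divide_eq) (simp add: D_def E_def algebra_simps)
    ultimately show ?thesis
      unfolding at gt by (simp only: add_divide_distrib times_divide_eq_left)
  qed
  have "\<alpha> *s (v j + (t + \<tau> i j k) *s w j) + \<gamma> *s (v k + (t + \<tau> i k j) *s w k)
    = (\<alpha> *s v j + (\<alpha> * (t + \<tau> i j k)) *s w j) + (\<gamma> *s v k + (\<gamma> * (t + \<tau> i k j)) *s w k)"
    by (simp only: vec.scale_right_distrib vec.scale_scale)
  also have "\<dots> = (t * (\<alpha> * p j + \<gamma> * p k) + ((\<alpha> * \<tau> i j k) * p j + (\<gamma> * \<tau> i k j) * p k)) *s a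
    + (\<alpha> * p j + \<gamma> * p k) *s a'
    + ((\<alpha> * s j + \<gamma> * s k + (\<alpha> * \<tau> i j k) * r j + (\<gamma> * \<tau> i k j) * r k)
        + t * (\<alpha> * r j + \<gamma> * r k)) *s b
    + (\<alpha> * r j + \<gamma> * r k) *s b'"
    unfolding vw_coord by (simp add: vec.scale_left_distrib algebra_simps)
  also have "\<dots> = (t * p i) *s a + p i *s a' + (s i + t * r i) *s b + r i *s b'"
    unfolding e3 e4[symmetric] e1[symmetric] e2[symmetric] by simp
  also have "\<dots> = v i + t *s w i"
    using vw_coord[of 1 i t] by simp
  finally show ?thesis by (simp add: \<alpha>_def \<gamma>_def)
qed

lemma persp_pt:
  assumes "i \<noteq> j" "i \<noteq> k" "j \<noteq> k"
  shows "persp L i j k (pt i t) = pt j (t + \<tau> i j k)"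
proof -
  let ?y = "v j + (t + \<tau> i j k) *s w j" and ?z = "v k + (t + \<tau> i k j) *s w k"
  have nz: "D i k / D j k \<noteq> 0" using assms D_nz by auto
  have mem: "x \<in> L l" if "x = v l + u *s w l" for x l u
    using L_mem[of 1 l u] that by simp
  have "persp L i j k (vec.span {v i + t *s w i}) = vec.span {(D i k / D j k) *s ?y}"
  proof (rule persp_span)
    show "v i + t *s w i - (D i k / D j k) *s ?y \<in> L k"
      unfolding decompose[OF assms, of t] add_diff_cancel_left'
      using mem[OF refl] by (rule vec.subspace_scale[OF subspace_L])
    show "(D i k / D j k) *s ?y \<in> L j"
      using mem[OF refl] by (rule vec.subspace_scale[OF subspace_L])
  qed (use subspace_L skew assms vtw_nz mem in auto)
  then show ?thesis unfolding span_scale_1[OF nz] pt_def .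
qed

text \<open>Multiplying Cramer's rule by \<epsilon> kills the \<epsilon>-parts of its coefficients,
  so only the quotients of the \<open>D\<close> remain.\<close>

lemma persp_inf_pt:
  assumes "i \<noteq> j" "i \<noteq> k" "j \<noteq> k"
  shows "persp L i j k (inf_pt i) = inf_pt j"
proof -
  have nz: "D i k / D j k \<noteq> 0" using assms D_nz by auto
  have mem: "w l \<in> L l" for l using L_mem[of 0 l 1] by simp
  have nz': "D j k \<noteq> 0" using D_nz assms by auto
  define \<alpha> \<gamma> where "\<alpha> = D i k / D j k" and "\<gamma> = D i j / D k j"
  have "D k j = - D j k" by (simp add: D_def)
  then have "p i = \<alpha> * p j + \<gamma> * p k" "r i = \<alpha> * r j + \<gamma> * r k"
    using nz' by (simp_all add: \<alpha>_def \<gamma>_def field_simps) (simp_all add: D_def algebra_simps)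
  then have "w i = (\<alpha> * p j + \<gamma> * p k) *s a + (\<alpha> * r j + \<gamma> * r k) *s b"
    unfolding w_def by presburger
  also have "\<dots> = \<alpha> *s w j + \<gamma> *s w k"
    unfolding w_def by (simp add: vec.scale_right_distrib vec.scale_left_distrib algebra_simps)
  finally have dec: "w i - \<alpha> *s w j = \<gamma> *s w k" by simp
  have "persp L i j k (vec.span {w i}) = vec.span {\<alpha> *s w j}"
  proof (rule persp_span)
    show "w i - \<alpha> *s w j \<in> L k" unfolding dec using mem by (rule vec.subspace_scale[OF subspace_L])
    show "\<alpha> *s w j \<in> L j" using mem by (rule vec.subspace_scale[OF subspace_L])
  qed (use subspace_L skew assms w_nz mem in auto)
  moreover have "\<alpha> \<noteq> 0" using nz by (simp add: \<alpha>_def)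
  ultimately show ?thesis using span_scale_1 by (simp add: inf_pt_def)
qed

end

section \<open>The groupoid acts by translations\<close>

context nilpotent_frame
begin

text \<open>Translation of the affine coordinate, fixing infinity. The function is extensional like
  the arrows of the groupoid, so that arrows can be equal to translations and not merely agree with
  them on points.\<close>

definition trans where
  "trans i j x = (\<lambda>q\<in>points_on (L i). if q = inf_pt i then inf_pt j else pt j ((THE t. q = pt i t) + x))"

lemma trans_pt [simp]: "trans i j x (pt i t) = pt j (t + x)"
  by (simp add: trans_def pt_mem)

lemma trans_inf_pt [simp]: "trans i j x (inf_pt i) = inf_pt j"
  by (simp add: trans_def inf_pt_mem)

lemma trans_eqI:
  assumes "g \<in> extensional (points_on (L i))" "g (inf_pt i) = inf_pt j" "\<And>t. g (pt i t) = pt j (t + x)"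
  shows "g = trans i j x"
proof (rule extensionalityI[OF assms(1)])
  show "trans i j x \<in> extensional (points_on (L i))" by (simp add: trans_def)
  show "g q = trans i j x q" if "q \<in> points_on (L i)" for q
    using that assms(2,3) by (auto simp: points_on_L)
qed

lemma trans_inject: "trans i j x = trans i j y \<Longrightarrow> x = y"
  by (metis trans_pt pt_eq_iff add_0)

lemma trans_id: "(\<lambda>q\<in>points_on (L i). q) = trans i i 0"
  by (rule trans_eqI) (auto simp: pt_mem inf_pt_mem)

lemma trans_compose: "compose (points_on (L i)) (trans j k y) (trans i j x) = trans i k (x + y)"
  by (rule trans_eqI) (auto simp: compose_eq pt_mem inf_pt_mem algebra_simps)

lemma persp_trans:
  assumes "j \<noteq> k" "j \<noteq> l" "k \<noteq> l" shows "persp L j k l = trans j k (\<tau> j k l)"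
proof (rule trans_eqI)
  show "persp L j k l \<in> extensional (points_on (L j))" unfolding persp_def by (rule restrict_extensional)
qed (simp_all add: persp_pt persp_inf_pt assms)

text \<open>The lengths of the translations given by arrows, generated in parallel with
  \<open>is_arrow\<close>. Questions about the groupoid become questions about subsets of the
  additive group of the field.\<close>

inductive shift :: "'i \<Rightarrow> 'i \<Rightarrow> 'a \<Rightarrow> bool" for i where
  ident: "shift i i 0"
| step: "shift i j x \<Longrightarrow> j \<noteq> k \<Longrightarrow> j \<noteq> l \<Longrightarrow> k \<noteq> l \<Longrightarrow> shift i k (x + \<tau> j k l)"

lemma is_arrow_iff: "is_arrow L i j g \<longleftrightarrow> (\<exists>x. shift i j x \<and> g = trans i j x)"
proof
  assume "is_arrow L i j g"
  then show "\<exists>x. shift i j x \<and> g = trans i j x"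
  proof induction
    case ident
    show ?case using trans_id shift.ident by blast
  next
    case (comp j g k l)
    then show ?case using shift.step persp_trans trans_compose by metis
  qed
next
  have "is_arrow L i j (trans i j x)" if "shift i j x" for x
    using that
  proof induction
    case ident
    show ?case using is_arrow.ident[of L i] by (simp add: trans_id)
  next
    case (step j x k l)
    then show ?case using is_arrow.comp[of L i j "trans i j x" k l] by (simp add: persp_trans trans_compose)
  qed
  then show "\<exists>x. shift i j x \<and> g = trans i j x \<Longrightarrow> is_arrow L i j g" by blast
qed

lemma arrows_eq: "arrows L i j = trans i j ` {x. shift i j x}"
  by (auto simp: arrows_def is_arrow_iff)

lemma shift_add: "shift j k y \<Longrightarrow> shift i j x \<Longrightarrow> shift i k (x + y)"
proof (induction rule: shift.induct)
  case (step k y l m)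
  then show ?case using shift.step[of i k "x + y" l m] by (simp add: add.assoc)
qed simp

lemma shift_uminus: "shift i j x \<Longrightarrow> shift j i (- x)"
proof (induction rule: shift.induct)
  case ident
  show ?case using shift.ident by simp
next
  case (step j x k l)
  \<comment> \<open>Exchanging source and target with the centre l kept inverts a perspectivity:
    \<open>\<tau> k j l\<close> is the negative of \<open>\<tau> j k l\<close>.\<close>
  have "shift k j (0 + \<tau> k j l)" using step by (intro shift.step shift.ident) auto
  from shift_add[OF step.IH this] show ?case by (simp add: \<tau>_def)
qed

lemma ex_shift: "\<exists>x. shift i j x"
proof (cases "i = j")
  case True
  then show ?thesis using shift.ident by blast
next
  case False
  obtain k where "k \<noteq> i" "k \<noteq> j" using distinct by (metis distinct_length_2_or_more)
  then show ?thesis using shift.step[OF shift.ident[of i], of j k] False by auto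
qed

lemma ex_shift_nz: obtains x where "shift i i x" "x \<noteq> 0"
proof -
  \<comment> \<open>The loop from i1 to i2 with centre i3 and back with centre i4; its length is
    exactly the expression in \<open>cross_ratio\<close>.\<close>
  have "shift i1 i1 ((0 + \<tau> i1 i2 i3) + \<tau> i2 i1 i4)"
    using distinct by (intro shift.step shift.ident) auto
  moreover have "(0 + \<tau> i1 i2 i3) + \<tau> i2 i1 i4 \<noteq> 0"
    using cross_ratio by (simp add: \<tau>_def D_def E_def algebra_simps)
  ultimately obtain x where x: "shift i1 i1 x" "x \<noteq> 0" by blast
  obtain y where y: "shift i i1 y" using ex_shift by blast
  \<comment> \<open>Conjugation by an arrow from i to i1 carries the loop to i and, additively,
    leaves its length unchanged.\<close>
  have "shift i i (y + x + - y)"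
    using shift_add[OF shift_uminus[OF y] shift_add[OF x(1) y]] .
  then show thesis using that[of x] x(2) by simp
qed

section \<open>Vertex groups and orbits\<close>

lemma carrier_vertex_group: "carrier (vertex_group L i) = trans i i ` {x. shift i i x}"
  by (simp add: vertex_group_def arrows_eq)

lemma mult_vertex_group:
  "trans i i x \<otimes>\<^bsub>vertex_group L i\<^esub> trans i i y = trans i i (y + x)"
  by (simp add: vertex_group_def trans_compose)

lemma one_vertex_group: "\<one>\<^bsub>vertex_group L i\<^esub> = trans i i 0"
  by (simp add: vertex_group_def trans_id)

lemma comm_group_vertex_group: "comm_group (vertex_group L i)"
proof (rule comm_groupI)
  fix g assume "g \<in> carrier (vertex_group L i)"
  then obtain x where x: "shift i i x" "g = trans i i x" by (auto simp: carrier_vertex_group)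
  then show "\<exists>h\<in>carrier (vertex_group L i). h \<otimes>\<^bsub>vertex_group L i\<^esub> g = \<one>\<^bsub>vertex_group L i\<^esub>"
    using shift_uminus[OF x(1)]
    by (intro bexI[of _ "trans i i (- x)"])
       (auto simp: carrier_vertex_group mult_vertex_group one_vertex_group)
next
  fix g h assume "g \<in> carrier (vertex_group L i)" "h \<in> carrier (vertex_group L i)"
  then obtain x y where "shift i i x" "g = trans i i x" "shift i i y" "h = trans i i y"
    by (auto simp: carrier_vertex_group)
  then show "g \<otimes>\<^bsub>vertex_group L i\<^esub> h \<in> carrier (vertex_group L i)"
    using shift_add[of i i x i y] by (auto simp: carrier_vertex_group mult_vertex_group)
qed (auto simp: carrier_vertex_group mult_vertex_group one_vertex_group algebra_simps
       intro: shift.ident)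

lemma embeds_vertex_group: "embeds_in_additive_group (vertex_group L i) TYPE('a)"
proof -
  let ?R = "add_monoid (ring_of_type_algebra :: 'a ring)"
  let ?H = "{x. shift i i x}"
  interpret R: abelian_group "ring_of_type_algebra :: 'a ring"
    using ring.is_abelian_group[OF ring_from_type_algebra] .
  interpret G: comm_group "vertex_group L i" by (rule comm_group_vertex_group)
  have inv: "inv\<^bsub>?R\<^esub> x = - x" for x
    by (rule group.inv_equality[OF R.a_group]) (simp_all add: ring_of_type_algebra_def)
  have H: "subgroup ?H ?R"
  proof (rule group.subgroupI[OF R.a_group])
    fix x y assume "x \<in> ?H" "y \<in> ?H"
    then show "x \<otimes>\<^bsub>?R\<^esub> y \<in> ?H"
      using shift_add by (auto simp: ring_of_type_algebra_def)
  next
    show "inv\<^bsub>?R\<^esub> x \<in> ?H" if "x \<in> ?H" for x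
      using that shift_uminus unfolding inv by simp
  qed (use shift.ident in \<open>auto simp: ring_of_type_algebra_def\<close>)
  have "trans i i \<in> iso (?R\<lparr>carrier := ?H\<rparr>) (vertex_group L i)"
  proof (rule isoI)
    show "trans i i \<in> hom (?R\<lparr>carrier := ?H\<rparr>) (vertex_group L i)"
      by (intro homI)
         (auto simp: carrier_vertex_group mult_vertex_group ring_of_type_algebra_def add.commute)
    show "bij_betw (trans i i) (carrier (?R\<lparr>carrier := ?H\<rparr>)) (carrier (vertex_group L i))"
      by (auto simp: bij_betw_def inj_on_def carrier_vertex_group dest: trans_inject)
  qed
  then have "?R\<lparr>carrier := ?H\<rparr> \<cong> vertex_group L i" by (auto simp: is_iso_def)
  then have "vertex_group L i \<cong> ?R\<lparr>carrier := ?H\<rparr>"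
    using group.iso_sym[OF subgroup.subgroup_is_group[OF H R.a_group]] by blast
  then show ?thesis using H unfolding embeds_in_additive_group_def by blast
qed

lemma point_cases:
  assumes "q \<in> points_on (L i)" "q \<noteq> inf_pt i" obtains t where "q = pt i t"
  using assms by (auto simp: points_on_L)

lemma acts_faithfully:
  assumes "q \<in> points_on (L i)" "q \<noteq> inf_pt i" shows "acts_faithfully_at L i q"
proof -
  obtain t where "q = pt i t" using assms by (rule point_cases)
  then show ?thesis
    by (auto simp: acts_faithfully_at_def carrier_vertex_group one_vertex_group)
qed

text \<open>Every length is a sum of values of \<open>\<tau>\<close>, of which there are finitely
  many because the index type is finite; in positive characteristic such sums stay in a finite
  set.\<close>

lemma finite_shift:
  assumes "CHAR('a) \<noteq> 0" shows "finite {x. shift i j x}"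
proof -
  have "finite (range (\<lambda>(j, k, l). \<tau> j k l))" by simp
  then obtain H where H: "finite H" "range (\<lambda>(j, k, l). \<tau> j k l) \<subseteq> H" "0 \<in> H"
      "\<And>x y. x \<in> H \<Longrightarrow> y \<in> H \<Longrightarrow> x + y \<in> H"
    using finite_additive_closure[OF _ assms] by metis
  have \<tau>: "\<tau> j k l \<in> H" for j k l using H(2) by (auto dest!: range_subsetD[where i = "(j, k, l)"])
  have "x \<in> H" if "shift i j x" for x
    using that by (induction rule: shift.induct) (simp_all add: H(3,4) \<tau>)
  then have "{x. shift i j x} \<subseteq> H" by blast
  then show ?thesis using H(1) by (rule finite_subset)
qed

lemma infinite_shift:
  assumes "CHAR('a) = 0" shows "infinite {x. shift i i x}"
proof -
  obtain x where x: "shift i i x" "x \<noteq> 0" by (rule ex_shift_nz)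
  have "shift i i (of_nat n * x)" for n
  proof (induction n)
    case (Suc n)
    then show ?case using shift_add[OF Suc x(1)] by (simp add: algebra_simps)
  qed (simp add: shift.ident)
  then have "range (\<lambda>n. of_nat n * x) \<subseteq> {x. shift i i x}" by auto
  moreover have "inj (\<lambda>n. of_nat n * x)"
  proof (rule linorder_injI)
    fix m n :: nat assume "m < n"
    then show "of_nat m * x \<noteq> of_nat n * x"
      using of_nat_eq_iff_char_dvd[where 'a = 'a, of m n] assms x(2) by auto
  qed
  ultimately show ?thesis using finite_subset range_inj_infinite by blast
qed

lemma infinite_vertex_group_iff: "infinite (carrier (vertex_group L i)) \<longleftrightarrow> CHAR('a) = 0"
proof -
  have "inj_on (trans i i) {x. shift i i x}" by (auto simp: inj_on_def dest: trans_inject)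
  then have "finite (carrier (vertex_group L i)) \<longleftrightarrow> finite {x. shift i i x}"
    unfolding carrier_vertex_group by (rule finite_image_iff)
  then show ?thesis using finite_shift[of i i] infinite_shift[of i] by auto
qed

lemma infinite_orbit_iff:
  assumes "q \<in> points_on (L i)" "q \<noteq> inf_pt i"
  shows "infinite (groupoid_orbit L i q) \<longleftrightarrow> CHAR('a) = 0"
proof -
  obtain t where t: "q = pt i t" using assms by (rule point_cases)
  \<comment> \<open>Arrows to different lines are treated together: for finiteness every member of
    the union over j counts, for infiniteness the member j = i is enough.\<close>
  have orbit: "groupoid_orbit L i q = (\<Union>j. (\<lambda>x. pt j (t + x)) ` {x. shift i j x})"
    by (auto simp: groupoid_orbit_def arrows_eq t image_iff) (metis trans_pt)+
  show ?thesis
  proof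
    show "infinite (groupoid_orbit L i q) \<Longrightarrow> CHAR('a) = 0"
      unfolding orbit using finite_shift by (auto intro!: finite_imageI)
    assume "CHAR('a) = 0"
    then have "infinite ((\<lambda>x. pt i (t + x)) ` {x. shift i i x})"
      using infinite_shift by (subst finite_image_iff) (auto simp: inj_on_def)
    then show "infinite (groupoid_orbit L i q)"
      unfolding orbit by (rule contrapos_nn) (erule finite_subset[rotated], blast)
  qed
qed

end

section \<open>Four skew lines as graphs\<close>

lemma skew_indep4:
  assumes "indep2 x y" "indep2 z u" "vec.span {x, y} \<inter> vec.span {z, u} = {0}"
  shows "indep4 x y z (u :: 'a::field ^ 'n)"
  unfolding indep4_def
proof (intro allI impI)
  fix c d e f assume "c *s x + d *s y + e *s z + f *s u = 0"
  then have "c *s x + d *s y = - (e *s z + f *s u)"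
    by (simp only: eq_neg_iff_add_eq_0 add.assoc)
  then have eq: "c *s x + d *s y = (- e) *s z + (- f) *s u" by simp
  then have "c *s x + d *s y \<in> vec.span {x, y} \<inter> vec.span {z, u}"
    unfolding span_2 by blast
  then have "c *s x + d *s y = 0" using assms(3) by blast
  moreover from this eq have "(- e) *s z + (- f) *s u = 0" by metis
  ultimately have "c = 0" "d = 0" "- e = 0" "- f = 0"
    using assms(1,2) unfolding indep2_def by blast+
  then show "c = 0 \<and> d = 0 \<and> e = 0 \<and> f = 0" by simp
qed

lemma eq_0_if_Int: "P \<inter> Q = {0} \<Longrightarrow> x \<in> P \<Longrightarrow> x \<in> Q \<Longrightarrow> x = 0"
  by blast

lemma proj_lineD: "proj_line U \<Longrightarrow> vec.subspace U"
  by (simp add: proj_line_def)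

lemma skew_lines_decompose:
  assumes "proj_line P" "proj_line Q" "P \<inter> Q = {0}"
  obtains y z where "y \<in> P" "z \<in> Q" "x = y + (z :: 'a::field ^ 4)"
proof -
  obtain f g where P: "indep2 f g" "P = vec.span {f, g}" using assms(1) by (rule proj_line_span2)
  obtain f' g' where Q: "indep2 f' g'" "Q = vec.span {f', g'}" using assms(2) by (rule proj_line_span2)
  have "indep4 f g f' g'" using P Q assms(3) by (intro skew_indep4) auto
  then have "x \<in> vec.span {f, g, f', g'}" by (simp add: indep4_span_UNIV)
  then obtain c d c' d' where x: "x = (c *s f + d *s g) + (c' *s f' + d' *s g')"
    unfolding span_4 by (auto simp: add.assoc)
  moreover have "c *s f + d *s g \<in> P" "c' *s f' + d' *s g' \<in> Q"
    unfolding P Q span_2 by blast+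
  ultimately show thesis using that by blast
qed

text \<open>A line R disjoint from Q projects injectively to P along Q, hence is the graph of a
  linear map from P to Q; x and y are the images of the chosen basis f, g of P.\<close>

lemma line_graph:
  assumes lines: "proj_line P" "proj_line Q" "proj_line R" "P \<inter> Q = {0}" "R \<inter> Q = {0}"
    and P: "P = vec.span {f, g}" "indep2 f g"
  obtains x y where "x \<in> Q" "y \<in> Q" "R = vec.span {f + x, g + (y :: 'a::field ^ 4)}"
proof -
  note sub = lines(1-3)[THEN proj_lineD]
  obtain k l where R: "indep2 k l" "R = vec.span {k, l}" using lines(3) by (rule proj_line_span2)
  obtain k1 k2 where k: "k1 \<in> P" "k2 \<in> Q" "k = k1 + k2" using lines(1,2,4) by (rule skew_lines_decompose)
  obtain l1 l2 where l: "l1 \<in> P" "l2 \<in> Q" "l = l1 + l2" using lines(1,2,4) by (rule skew_lines_decompose)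
  have comb: "c *s k + d *s l = (c *s k1 + d *s l1) + (c *s k2 + d *s l2)" for c d
    unfolding k l by (simp add: vec.scale_right_distrib)
  have Qc: "c *s k2 + d *s l2 \<in> Q" for c d
    by (intro vec.subspace_add vec.subspace_scale sub k l)
  have Rc: "c *s k + d *s l \<in> R" for c d
    unfolding R span_2 by blast
  have "indep2 k1 l1"
    unfolding indep2_def
  proof (intro allI impI)
    fix c d assume "c *s k1 + d *s l1 = 0"
    then have "c *s k + d *s l \<in> R \<inter> Q" using comb[of c d] Qc[of c d] Rc[of c d] by simp
    then have "c *s k + d *s l = 0" using lines(5) by blast
    then show "c = 0 \<and> d = 0" using R(1) unfolding indep2_def by blast
  qed
  then have Pkl: "P = vec.span {k1, l1}" using lines(1) k l by (intro proj_line_eq_span2)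
  have "f \<in> P" "g \<in> P" unfolding P(1) by (auto intro: vec.span_base)
  then obtain c d c' d' where fg: "f = c *s k1 + d *s l1" "g = c' *s k1 + d' *s l1"
    unfolding Pkl span_2 by blast
  define x y where "x = c *s k2 + d *s l2" and "y = c' *s k2 + d' *s l2"
  have xy: "x \<in> Q" "y \<in> Q" unfolding x_def y_def by (rule Qc)+
  have in_R: "f + x \<in> R" "g + y \<in> R"
    unfolding fg x_def y_def comb[symmetric] by (rule Rc)+
  have "indep2 (f + x) (g + y)"
    unfolding indep2_def
  proof (intro allI impI)
    fix c d assume "c *s (f + x) + d *s (g + y) = 0"
    then have "(c *s f + d *s g) + (c *s x + d *s y) = 0"
      by (simp add: vec.scale_right_distrib algebra_simps)
    then have "c *s f + d *s g = - (c *s x + d *s y)" by (rule eq_neg_iff_add_eq_0[THEN iffD2])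
    moreover have "- (c *s x + d *s y) \<in> Q"
      by (intro vec.subspace_neg vec.subspace_add vec.subspace_scale sub xy)
    moreover have "c *s f + d *s g \<in> P" unfolding P(1) span_2 by blast
    ultimately have "c *s f + d *s g \<in> P \<inter> Q" by (metis IntI)
    then have "c *s f + d *s g = 0" using lines(4) by blast
    then show "c = 0 \<and> d = 0" using P(2) unfolding indep2_def by blast
  qed
  then have "R = vec.span {f + x, g + y}" using lines(3) in_R by (intro proj_line_eq_span2)
  then show thesis using that xy by blast
qed

lemma det_0_kernel:
  fixes a b c d :: "'a::field"
  assumes "a * d - b * c = 0"
  obtains t u where "t \<noteq> 0 \<or> u \<noteq> 0" "a * t + b * u = 0" "c * t + d * u = 0"
proof (cases "c = 0 \<and> d = 0")
  case True
  show thesis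
  proof (cases "a = 0 \<and> b = 0")
    case True
    then show thesis using that[of 1 0] \<open>c = 0 \<and> d = 0\<close> by simp
  next
    case False
    then show thesis using that[of b "- a"] \<open>c = 0 \<and> d = 0\<close> by auto
  qed
next
  case False
  then show thesis using that[of d "- c"] assms by (auto simp: mult.commute)
qed

lemma span_2_change:
  assumes "c * f - d * e \<noteq> 0"
  shows "vec.span {c *s x + d *s y, e *s x + f *s y} = vec.span {x, y :: 'a::field ^ 'n}"
    (is "vec.span {?u, ?v} = _")
proof
  have "vec.subspace (vec.span {x, y})" by simp
  moreover have "{?u, ?v} \<subseteq> vec.span {x, y}" unfolding span_2 by blast
  ultimately show "vec.span {?u, ?v} \<subseteq> vec.span {x, y}" by (rule vec.span_minimal[rotated])
  define k where "k = c * f - d * e"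
  have k: "k \<noteq> 0" using assms by (simp add: k_def)
  have "f *s ?u + (- d) *s ?v = (f * c + - d * e) *s x + (f * d + - d * f) *s y"
    by (simp only: vec.scale_right_distrib vec.scale_left_distrib vec.scale_scale) (simp add: algebra_simps)
  also have "\<dots> = k *s x" by (simp add: k_def algebra_simps)
  finally have *: "f *s ?u + (- d) *s ?v = k *s x" .
  have "x = inverse k *s (f *s ?u + (- d) *s ?v)" unfolding * using k by simp
  also have "\<dots> = (inverse k * f) *s ?u + (inverse k * - d) *s ?v"
    by (simp only: vec.scale_right_distrib vec.scale_scale mult.assoc)
  finally have x: "x = (inverse k * f) *s ?u + (inverse k * - d) *s ?v" .
  have "(- e) *s ?u + c *s ?v = (- e * c + c * e) *s x + (- e * d + c * f) *s y"
    by (simp only: vec.scale_right_distrib vec.scale_left_distrib vec.scale_scale) (simp add: algebra_simps)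
  also have "\<dots> = k *s y" by (simp add: k_def algebra_simps)
  finally have *: "(- e) *s ?u + c *s ?v = k *s y" .
  have "y = inverse k *s ((- e) *s ?u + c *s ?v)" unfolding * using k by simp
  also have "\<dots> = (inverse k * - e) *s ?u + (inverse k * c) *s ?v"
    by (simp only: vec.scale_right_distrib vec.scale_scale mult.assoc)
  finally have y: "y = (inverse k * - e) *s ?u + (inverse k * c) *s ?v" .
  have "x \<in> vec.span {?u, ?v}" "y \<in> vec.span {?u, ?v}"
    unfolding span_2[of ?u ?v] using x y by blast+
  then have "{x, y} \<subseteq> vec.span {?u, ?v}" by simp
  then show "vec.span {x, y} \<subseteq> vec.span {?u, ?v}" by (rule vec.span_minimal) simp
qed

text \<open>The columns of the matrix M are the images of \<open>e1\<close> and \<open>e2\<close> in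
  the basis \<open>e3\<close>, \<open>e4\<close>. As \<open>L i4\<close> is a graph over
  \<open>L i1\<close>, it misses \<open>L i2\<close> by construction; \<open>det\<close> and
  \<open>det1\<close> say that it misses \<open>L i1\<close> and the diagonal
  \<open>L i3\<close>.\<close>

locale four_lines =
  fixes L :: "4 \<Rightarrow> ('a::field ^ 4) set" and i1 i2 i3 i4 :: 4
    and e1 e2 e3 e4 :: "'a ^ 4" and m11 m12 m21 m22 :: 'a
  assumes distinct: "distinct [i1, i2, i3, i4]"
    and indep: "indep4 e1 e2 e3 e4"
    and L1: "L i1 = vec.span {e1, e2}" and L2: "L i2 = vec.span {e3, e4}"
    and L3: "L i3 = vec.span {e1 + e3, e2 + e4}"
    and L4: "L i4 = vec.span {e1 + (m11 *s e3 + m21 *s e4), e2 + (m12 *s e3 + m22 *s e4)}"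
    and det: "m11 * m22 - m12 * m21 \<noteq> 0" and det1: "(m11 - 1) * (m22 - 1) - m12 * m21 \<noteq> 0"
begin

definition co where "co c d e f = c *s e1 + d *s e2 + e *s e3 + f *s e4"

lemma co_eq_iff [simp]: "co c d e f = co c' d' e' f' \<longleftrightarrow> c = c' \<and> d = d' \<and> e = e' \<and> f = f'"
  unfolding co_def by (rule indep4_eq_iff[OF indep])

lemma co_0: "co 0 0 0 0 = 0"
  by (simp add: co_def)

lemma co_eq_0_iff [simp]: "co c d e f = 0 \<longleftrightarrow> c = 0 \<and> d = 0 \<and> e = 0 \<and> f = 0"
  using co_eq_iff[of c d e f 0 0 0 0] unfolding co_0 .

lemma co_add: "co c d e f + co c' d' e' f' = co (c + c') (d + d') (e + e') (f + f')"
  by (simp add: co_def vec.scale_left_distrib algebra_simps)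

lemma co_scale: "k *s co c d e f = co (k * c) (k * d) (k * e) (k * f)"
  by (simp add: co_def vec.scale_right_distrib)

lemma co_cases: obtains c d e f where "x = co c d e f"
proof -
  have "x \<in> vec.span {e1, e2, e3, e4}" by (simp add: indep4_span_UNIV[OF indep])
  then show thesis using that unfolding span_4 co_def by blast
qed

lemma mem_L:
  "x \<in> L i1 \<longleftrightarrow> (\<exists>s t. x = co s t 0 0)"
  "x \<in> L i2 \<longleftrightarrow> (\<exists>s t. x = co 0 0 s t)"
  "x \<in> L i3 \<longleftrightarrow> (\<exists>s t. x = co s t s t)"
  "x \<in> L i4 \<longleftrightarrow> (\<exists>s t. x = co s t (m11 * s + m12 * t) (m21 * s + m22 * t))"
proof -
  have 3: "s *s (e1 + e3) + t *s (e2 + e4) = co s t s t" for s t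
    by (simp add: co_def vec.scale_right_distrib algebra_simps)
  have 4: "s *s (e1 + (m11 *s e3 + m21 *s e4)) + t *s (e2 + (m12 *s e3 + m22 *s e4))
      = co s t (m11 * s + m12 * t) (m21 * s + m22 * t)" for s t
    by (simp add: co_def vec.scale_right_distrib vec.scale_left_distrib algebra_simps)
  show "x \<in> L i1 \<longleftrightarrow> (\<exists>s t. x = co s t 0 0)" "x \<in> L i2 \<longleftrightarrow> (\<exists>s t. x = co 0 0 s t)"
    unfolding L1 L2 span_2 by (simp_all add: co_def)
  show "x \<in> L i3 \<longleftrightarrow> (\<exists>s t. x = co s t s t)"
    unfolding L3 span_2 3 by simp
  show "x \<in> L i4 \<longleftrightarrow> (\<exists>s t. x = co s t (m11 * s + m12 * t) (m21 * s + m22 * t))"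
    unfolding L4 span_2 4 by simp
qed

lemma index_cases: "i = i1 \<or> i = i2 \<or> i = i3 \<or> i = i4"
proof -
  have "card {i1, i2, i3, i4} = card (UNIV :: 4 set)" using distinct by simp
  then have "{i1, i2, i3, i4} = (UNIV :: 4 set)" by (intro card_subset_eq) simp_all
  then show ?thesis by blast
qed

end

lemma skew_lines_four_lines:
  assumes skew: "skew_lines L" and distinct: "distinct [i1, i2, i3, i4]"
  obtains e1 e2 e3 e4 m11 m12 m21 m22 where "four_lines L i1 i2 i3 i4 e1 e2 e3 e4 m11 m12 m21 m22"
proof -
  have line: "proj_line (L i)" for i using skew by (simp add: skew_lines_def)
  have skew': "i \<noteq> j \<Longrightarrow> L i \<inter> L j = {0}" for i j using skew by (simp add: skew_lines_def)
  have "i1 \<noteq> i2" "i3 \<noteq> i2" "i4 \<noteq> i2" "i3 \<noteq> i1" "i4 \<noteq> i1" "i4 \<noteq> i3" using distinct by auto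
  then have skews: "L i1 \<inter> L i2 = {0}" "L i3 \<inter> L i2 = {0}" "L i4 \<inter> L i2 = {0}"
      "L i3 \<inter> L i1 = {0}" "L i4 \<inter> L i1 = {0}" "L i4 \<inter> L i3 = {0}"
    by (simp_all add: skew')
  obtain e1 e2 where e12: "indep2 e1 e2" "L i1 = vec.span {e1, e2}" using line by (rule proj_line_span2)
  \<comment> \<open>The basis of \<open>L i2\<close> is taken to be the image of \<open>e1\<close>,
    \<open>e2\<close> under the map whose graph is \<open>L i3\<close>; this turns the third line
    into the diagonal.\<close>
  obtain e3 e4 where e34: "e3 \<in> L i2" "e4 \<in> L i2" and L3: "L i3 = vec.span {e1 + e3, e2 + e4}"
    by (rule line_graph[OF line[of i1] line[of i2] line[of i3] skews(1,2) e12(2) e12(1)])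
  have i34: "indep2 e3 e4"
    unfolding indep2_def
  proof (intro allI impI)
    fix c d assume "c *s e3 + d *s e4 = 0"
    then have "c *s e1 + d *s e2 = (c *s e1 + d *s e2) + (c *s e3 + d *s e4)" by simp
    also have "\<dots> = c *s (e1 + e3) + d *s (e2 + e4)"
      by (simp add: vec.scale_right_distrib algebra_simps)
    finally have "c *s e1 + d *s e2 = c *s (e1 + e3) + d *s (e2 + e4)" .
    then have "c *s e1 + d *s e2 \<in> L i3 \<inter> L i1"
      unfolding L3 e12(2) span_2 by blast
    then have "c *s e1 + d *s e2 = 0" using skews by blast
    then show "c = 0 \<and> d = 0" using e12(1) unfolding indep2_def by blast
  qed
  then have L2: "L i2 = vec.span {e3, e4}" using line e34 by (intro proj_line_eq_span2)
  obtain x y where "x \<in> L i2" "y \<in> L i2" and L4: "L i4 = vec.span {e1 + x, e2 + y}"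
    by (rule line_graph[OF line[of i1] line[of i2] line[of i4] skews(1,3) e12(2) e12(1)])
  then obtain m11 m21 m12 m22 where x: "x = m11 *s e3 + m21 *s e4" and y: "y = m12 *s e3 + m22 *s e4"
    unfolding L2 span_2 by blast
  have indep: "indep4 e1 e2 e3 e4"
    using skews(1) e12 i34 L2 by (intro skew_indep4) simp_all
  have S: "t *s (e1 + x) + u *s (e2 + y) \<in> L i4" for t u
    unfolding L4 span_2 by blast
  have S_eq: "t *s (e1 + x) + u *s (e2 + y) =
      t *s e1 + u *s e2 + (m11 * t + m12 * u) *s e3 + (m21 * t + m22 * u) *s e4" for t u
    unfolding x y by (simp add: vec.scale_right_distrib vec.scale_left_distrib algebra_simps)
  have nz: "t = 0 \<and> u = 0" if "t *s e1 + u *s e2 + c *s e3 + d *s e4 = 0" for t u c d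
    using that indep unfolding indep4_def by blast
  have "m11 * m22 - m12 * m21 \<noteq> 0"
  proof
    assume "m11 * m22 - m12 * m21 = 0"
    then obtain t u where tu: "t \<noteq> 0 \<or> u \<noteq> 0" "m11 * t + m12 * u = 0" "m21 * t + m22 * u = 0"
      by (rule det_0_kernel)
    have "t *s (e1 + x) + u *s (e2 + y) \<in> L i1"
      unfolding S_eq tu e12(2) span_2 by simp blast
    then have "t *s (e1 + x) + u *s (e2 + y) = 0"
      by (rule eq_0_if_Int[OF skews(5) S])
    then show False unfolding S_eq using nz tu(1) by blast
  qed
  moreover have "(m11 - 1) * (m22 - 1) - m12 * m21 \<noteq> 0"
  proof
    assume "(m11 - 1) * (m22 - 1) - m12 * m21 = 0"
    then obtain t u where tu: "t \<noteq> 0 \<or> u \<noteq> 0" "(m11 - 1) * t + m12 * u = 0" "m21 * t + (m22 - 1) * u = 0"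
      by (rule det_0_kernel)
    have eq: "m11 * t + m12 * u = t" "m21 * t + m22 * u = u"
      using tu(2,3) by (simp_all add: algebra_simps)
    have "t *s e1 + u *s e2 + t *s e3 + u *s e4 = t *s (e1 + e3) + u *s (e2 + e4)"
      by (simp add: vec.scale_right_distrib algebra_simps)
    then have "t *s (e1 + x) + u *s (e2 + y) \<in> L i3"
      unfolding S_eq eq L3 span_2 by blast
    then have "t *s (e1 + x) + u *s (e2 + y) = 0"
      by (rule eq_0_if_Int[OF skews(6) S])
    then show False unfolding S_eq using nz tu(1) by blast
  qed
  ultimately show thesis
    using that[of e1 e2 e3 e4 m11 m12 m21 m22] distinct indep e12 L2 L3 L4 x y
    by (simp add: four_lines_def)
qed

section \<open>Transversals of multiplicity 2\<close>

text \<open>This is the polarization Q(x + y) - Q(x) - Q(y), written through the gradient because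
  tangency is its vanishing. In characteristic 2 it does not determine Q, so the form and its
  polarization are computed side by side.\<close>

definition polar :: "'a::field ^ 4 ^ 4 \<Rightarrow> 'a ^ 4 \<Rightarrow> 'a ^ 4 \<Rightarrow> 'a" where
  "polar A x y = (\<Sum>n\<in>UNIV. quad_grad A x $ n * y $ n)"

lemma quad_form_add: "quad_form A (x + y) = quad_form A x + quad_form A y + polar A x y"
  unfolding quad_form_def polar_def quad_grad_def sum_4 by (simp add: algebra_simps)

lemma quad_form_scale: "quad_form A (c *s x) = c * c * quad_form A x"
  unfolding quad_form_def sum_4 by (simp add: algebra_simps)

lemma polar_simps:
  "polar A (x + x') y = polar A x y + polar A x' y"
  "polar A x (y + y') = polar A x y + polar A x y'"
  "polar A (c *s x) y = c * polar A x y"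
  "polar A x (c *s y) = c * polar A x y"
  unfolding polar_def quad_grad_def sum_4 by (simp_all add: algebra_simps)

lemma polar_sym: "polar A x y = polar A y x"
  unfolding polar_def quad_grad_def sum_4 by (simp add: algebra_simps)

lemma polar_self: "polar A x x = 2 * quad_form A x"
  unfolding polar_def quad_grad_def quad_form_def sum_4 by (simp add: algebra_simps)

section \<open>The quadric through three lines, and transversals as eigenvectors\<close>

context four_lines
begin

text \<open>Vanishing on the three lines kills all coefficients in the basis \<open>e1\<close>, ...,
  \<open>e4\<close> except those of c f and d e, and the diagonal forces these to be opposite. What
  remains is a multiple of the determinant of the 2 by 2 matrix with rows (c, d) and (e, f).\<close>

lemma quadric_through_three_lines:
  assumes "L i1 \<subseteq> quadric A" "L i2 \<subseteq> quadric A" "L i3 \<subseteq> quadric A"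
  obtains k where "\<And>c d e f. quad_form A (co c d e f) = k * (c * f - d * e)"
    "\<And>c d e f c' d' e' f'. polar A (co c d e f) (co c' d' e' f') =
        k * (c * f' + f * c' - d * e' - e * d')"
proof -
  have q1: "quad_form A (co s t 0 0) = 0" and q2: "quad_form A (co 0 0 s t) = 0"
    and q3: "quad_form A (co s t s t) = 0" for s t
    using assms mem_L unfolding quadric_def by blast+
  have e0: "quad_form A e1 = 0" "quad_form A e2 = 0" "quad_form A e3 = 0" "quad_form A e4 = 0"
    using q1[of 1 0] q1[of 0 1] q2[of 1 0] q2[of 0 1] by (simp_all add: co_def)
  have "quad_form A (e1 + e2) = 0" "quad_form A (e3 + e4) = 0" "quad_form A (e1 + e3) = 0"
      "quad_form A (e2 + e4) = 0" "quad_form A ((e1 + e3) + (e2 + e4)) = 0"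
    using q1[of 1 1] q2[of 1 1] q3[of 1 0] q3[of 0 1] q3[of 1 1] by (simp_all add: co_def algebra_simps)
  then have b: "polar A e1 e2 = 0" "polar A e3 e4 = 0" "polar A e1 e3 = 0" "polar A e2 e4 = 0"
    and "polar A e2 e3 + polar A e1 e4 = 0"
    using polar_sym[of A e3 e2] by (simp_all add: quad_form_add e0 polar_simps)
  then have b': "polar A e2 e3 = - polar A e1 e4" by (simp only: eq_neg_iff_add_eq_0)
  have self: "polar A e1 e1 = 0" "polar A e2 e2 = 0" "polar A e3 e3 = 0" "polar A e4 e4 = 0"
    by (simp_all add: polar_self e0)
  note all = e0 b b' self polar_sym[of A e2 e1] polar_sym[of A e3 e1] polar_sym[of A e4 e1]
    polar_sym[of A e3 e2] polar_sym[of A e4 e2] polar_sym[of A e4 e3]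
  have "quad_form A (co c d e f) = polar A e1 e4 * (c * f - d * e)" for c d e f
    by (simp add: co_def quad_form_add quad_form_scale polar_simps all algebra_simps)
  moreover have "polar A (co c d e f) (co c' d' e' f') =
      polar A e1 e4 * (c * f' + f * c' - d * e' - e * d')" for c d e f c' d' e' f'
    by (simp add: co_def polar_simps all algebra_simps)
  ultimately show thesis using that by blast
qed

lemma eigenvector_span:
  assumes "v1 \<noteq> 0 \<or> v2 \<noteq> 0"
  shows "indep2 (co v1 v2 0 0) (co 0 0 v1 v2)"
  unfolding indep2_def co_scale co_add using assms by auto

text \<open>T is spanned by its points (v, 0) and (0, u) on the first two lines. Meeting the
  diagonal makes u proportional to v, and meeting the graph of M then makes M v proportional to
  v.\<close>

lemma transversal_eigenvector:
  assumes "transversal L T"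
  obtains v1 v2 \<mu> where "v1 \<noteq> 0 \<or> v2 \<noteq> 0"
    "m11 * v1 + m12 * v2 = \<mu> * v1" "m21 * v1 + m22 * v2 = \<mu> * v2"
    "T = vec.span {co v1 v2 0 0, co 0 0 v1 v2}"
proof -
  have T: "proj_line T" and meet: "T \<inter> L i \<noteq> {0}" for i
    using assms by (simp_all add: transversal_def)
  have sub: "vec.subspace T" using T by (rule proj_lineD)
  have meetE: "\<exists>x. x \<in> T \<and> x \<in> L i \<and> x \<noteq> 0" for i
  proof -
    have "0 \<in> L i"
      using mem_L[of 0] co_eq_0_iff index_cases[of i] by (metis mult_zero_right add_0)
    then show ?thesis using meet[of i] vec.subspace_0[OF sub] by blast
  qed
  obtain v1 v2 where v: "co v1 v2 0 0 \<in> T" "v1 \<noteq> 0 \<or> v2 \<noteq> 0"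
    using meetE[of i1] unfolding mem_L by auto
  obtain u1 u2 where u: "co 0 0 u1 u2 \<in> T" "u1 \<noteq> 0 \<or> u2 \<noteq> 0"
    using meetE[of i2] unfolding mem_L by auto
  have "indep2 (co v1 v2 0 0) (co 0 0 u1 u2)"
    unfolding indep2_def co_scale co_add using u v by auto
  then have Tuv: "T = vec.span {co v1 v2 0 0, co 0 0 u1 u2}" using T u v by (intro proj_line_eq_span2)
  obtain s t where st: "co s t s t \<in> T" "s \<noteq> 0 \<or> t \<noteq> 0"
    using meetE[of i3] unfolding mem_L by auto
  then obtain \<alpha> \<beta> where "co s t s t = \<alpha> *s co v1 v2 0 0 + \<beta> *s co 0 0 u1 u2"
    unfolding Tuv span_2 by blast
  then have ab: "s = \<alpha> * v1" "t = \<alpha> * v2" "\<alpha> * v1 = \<beta> * u1" "\<alpha> * v2 = \<beta> * u2"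
    unfolding co_scale co_add by auto
  then have "\<alpha> \<noteq> 0" using st(2) by auto
  then have "v1 = \<beta> / \<alpha> * u1" "v2 = \<beta> / \<alpha> * u2"
    using ab(3,4) by (simp_all add: field_simps)
  then have "co 0 0 v1 v2 = (\<beta> / \<alpha>) *s co 0 0 u1 u2" unfolding co_scale by simp
  then have "co 0 0 v1 v2 \<in> T" using u(1) vec.subspace_scale[OF sub] by metis
  then have Tv: "T = vec.span {co v1 v2 0 0, co 0 0 v1 v2}"
    using T v eigenvector_span by (intro proj_line_eq_span2) auto
  obtain s' t' where st': "co s' t' (m11 * s' + m12 * t') (m21 * s' + m22 * t') \<in> T"
      "co s' t' (m11 * s' + m12 * t') (m21 * s' + m22 * t') \<noteq> 0"
    using meetE[of i4] unfolding mem_L by blast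
  then obtain \<gamma> \<delta> where "co s' t' (m11 * s' + m12 * t') (m21 * s' + m22 * t')
      = \<gamma> *s co v1 v2 0 0 + \<delta> *s co 0 0 v1 v2"
    unfolding Tv span_2 by blast
  then have cd: "s' = \<gamma> * v1" "t' = \<gamma> * v2" "m11 * s' + m12 * t' = \<delta> * v1" "m21 * s' + m22 * t' = \<delta> * v2"
    unfolding co_scale co_add by auto
  then have nz: "\<gamma> \<noteq> 0" using st'(2) by auto
  have "\<gamma> * (m11 * v1 + m12 * v2) = \<delta> * v1" "\<gamma> * (m21 * v1 + m22 * v2) = \<delta> * v2"
    using cd(3,4) unfolding cd(1,2) by (simp_all add: algebra_simps)
  then have "m11 * v1 + m12 * v2 = \<delta> / \<gamma> * v1" "m21 * v1 + m22 * v2 = \<delta> / \<gamma> * v2"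
    using nz by (simp_all add: field_simps)
  then show thesis using that v(2) Tv by blast
qed

end

text \<open>Tangency at $T \<inter> L_4$ says that $M$ acts on the quotient by the eigenvector $v$
  with the same eigenvalue \<open>\<mu>\<close>, and $M$ is not scalar as $L_4$ does not lie on the quadric.\<close>
lemma (in four_lines) multiplicity_2_eigenvalue:
  fixes A :: "'a ^ 4 ^ 4"
  assumes nondegenerate: "\<And>x. x \<noteq> 0 \<Longrightarrow> \<not> (quad_form A x = 0 \<and> quad_grad A x = 0)"
    and contains: "L i1 \<subseteq> quadric A" "L i2 \<subseteq> quadric A" "L i3 \<subseteq> quadric A" "\<not> L i4 \<subseteq> quadric A"
    and tangent: "\<And>x y. x \<in> L i4 \<inter> T \<Longrightarrow> y \<in> L i4 \<Longrightarrow> polar A x y = 0"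
    and "transversal L T"
  obtains v1 v2 \<mu> where "v1 \<noteq> 0 \<or> v2 \<noteq> 0"
    "m11 * v1 + m12 * v2 = \<mu> * v1" "m21 * v1 + m22 * v2 = \<mu> * v2"
    "T = vec.span {co v1 v2 0 0, co 0 0 v1 v2}"
    "m11 + m22 = 2 * \<mu>" "(m11 - \<mu>) * (m22 - \<mu>) = m12 * m21" "m12 \<noteq> 0 \<or> m21 \<noteq> 0"
proof -
  obtain k where Q: "\<And>c d e f. quad_form A (co c d e f) = k * (c * f - d * e)"
    and B: "\<And>c d e f c' d' e' f'. polar A (co c d e f) (co c' d' e' f') =
        k * (c * f' + f * c' - d * e' - e * d')"
    using quadric_through_three_lines[OF contains(1-3)] by metis
  obtain v1 v2 \<mu> where v: "v1 \<noteq> 0 \<or> v2 \<noteq> 0"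
    and eigen: "m11 * v1 + m12 * v2 = \<mu> * v1" "m21 * v1 + m22 * v2 = \<mu> * v2"
    and T: "T = vec.span {co v1 v2 0 0, co 0 0 v1 v2}"
    using transversal_eigenvector[OF \<open>transversal L T\<close>] by metis
  \<comment> \<open>For k = 0 the gradient would vanish at a point of \<open>L i1\<close>, which
    lies on the quadric.\<close>
  have k: "k \<noteq> 0"
  proof
    assume "k = 0"
    have "polar A (co 1 0 0 0) x = 0" for x
    proof -
      obtain c d e f where "x = co c d e f" by (rule co_cases)
      then show ?thesis using B \<open>k = 0\<close> by simp
    qed
    from this[of "axis _ 1"] have "quad_grad A (co 1 0 0 0) $ n = 0" for n
      unfolding polar_def by (simp add: axis_def if_distrib cong: if_cong)
    then have "quad_grad A (co 1 0 0 0) = 0" by (simp add: vec_eq_iff)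
    then show False using nondegenerate[of "co 1 0 0 0"] Q by simp
  qed
  have "co v1 v2 (\<mu> * v1) (\<mu> * v2) = 1 *s co v1 v2 0 0 + \<mu> *s co 0 0 v1 v2"
    unfolding co_scale co_add by simp
  then have "co v1 v2 (\<mu> * v1) (\<mu> * v2) \<in> T" unfolding T span_2 by blast
  moreover have "co v1 v2 (\<mu> * v1) (\<mu> * v2) \<in> L i4"
    unfolding mem_L eigen[symmetric] by blast
  ultimately have q: "co v1 v2 (\<mu> * v1) (\<mu> * v2) \<in> L i4 \<inter> T" by blast
  have "co 1 0 m11 m21 \<in> L i4" "co 0 1 m12 m22 \<in> L i4"
    unfolding mem_L by (auto intro: exI[of _ 1] exI[of _ 0])
  from this[THEN tangent[OF q]] have tang: "v1 * m21 + \<mu> * v2 - v2 * m11 = 0"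
      "v1 * m22 - v2 * m12 - \<mu> * v1 = 0"
    using k by (simp_all add: B)
  \<comment> \<open>Combining tangency with the eigenvector equation gives (tr M - 2 \<mu>) v = 0,
    without dividing by 2.\<close>
  have "v1 * (m11 + m22 - 2 * \<mu>) = (m11 * v1 + m12 * v2 - \<mu> * v1) + (v1 * m22 - v2 * m12 - \<mu> * v1)"
    by (simp add: algebra_simps)
  also have "\<dots> = 0" unfolding tang eigen by simp
  finally have t1: "v1 * (m11 + m22 - 2 * \<mu>) = 0" .
  have "v2 * (m11 + m22 - 2 * \<mu>) = (m21 * v1 + m22 * v2 - \<mu> * v2) - (v1 * m21 + \<mu> * v2 - v2 * m11)"
    by (simp add: algebra_simps)
  also have "\<dots> = 0" unfolding tang eigen by simp
  finally have t2: "v2 * (m11 + m22 - 2 * \<mu>) = 0" .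
  have tr: "m11 + m22 = 2 * \<mu>" using t1 t2 v by auto
  let ?\<delta> = "(m11 - \<mu>) * (m22 - \<mu>) - m12 * m21"
  \<comment> \<open>The adjugate of M - \<mu> applied to (M - \<mu>) v = 0 gives det (M - \<mu>) v =
    0.\<close>
  have "v1 * ?\<delta> = (m22 - \<mu>) * (m11 * v1 + m12 * v2 - \<mu> * v1) - m12 * (m21 * v1 + m22 * v2 - \<mu> * v2)"
    by (simp add: algebra_simps)
  also have "\<dots> = 0" unfolding eigen by simp
  finally have d1: "v1 * ?\<delta> = 0" .
  have "v2 * ?\<delta> = (m11 - \<mu>) * (m21 * v1 + m22 * v2 - \<mu> * v2) - m21 * (m11 * v1 + m12 * v2 - \<mu> * v1)"
    by (simp add: algebra_simps)
  also have "\<dots> = 0" unfolding eigen by simp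
  finally have d2: "v2 * ?\<delta> = 0" .
  have det: "(m11 - \<mu>) * (m22 - \<mu>) = m12 * m21" using d1 d2 v by auto
  have "m12 \<noteq> 0 \<or> m21 \<noteq> 0"
  proof (rule ccontr)
    assume "\<not> (m12 \<noteq> 0 \<or> m21 \<noteq> 0)"
    then have 0: "m12 = 0" "m21 = 0" by auto
    then have "m11 = \<mu> \<or> m22 = \<mu>" using det by auto
    then have "m11 = \<mu>" "m22 = \<mu>" using tr by auto
    then have "L i4 \<subseteq> quadric A" using 0 by (auto simp: mem_L quadric_def Q)
    then show False using contains by blast
  qed
  then show thesis using that v eigen T tr det by blast
qed

text \<open>The span of \<open>a\<close> and \<open>b\<close> is \<epsilon> V. A vector c e_i + e
  \<epsilon> e_i lies in it only if c (p_i, r_i) = 0, that is c = 0.\<close>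

lemma (in nilpotent_frame) span_Int_L: "vec.span {a, b} \<inter> L i = inf_pt i"
proof (intro subset_antisym subsetI)
  fix x assume "x \<in> vec.span {a, b} \<inter> L i"
  then have "x \<in> vec.span {a, b}" "x \<in> vec.span {v i, w i}" by (simp_all add: L_span)
  then obtain \<alpha> \<beta> c e where x: "x = \<alpha> *s a + \<beta> *s b" "x = c *s v i + e *s w i"
    unfolding span_2 by blast
  then have "(e * p i) *s a + (c * p i) *s a' + (c * s i + e * r i) *s b + (c * r i) *s b'
      = \<alpha> *s a + 0 *s a' + \<beta> *s b + 0 *s b'"
    unfolding vw_coord by simp
  then have "c * p i = 0" "c * r i = 0" unfolding indep4_eq_iff[OF indep] by blast+
  then have "c = 0" using pr_nz[of i] by auto
  then show "x \<in> inf_pt i" using x(2) by (auto simp: inf_pt_def span_1)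
next
  fix x assume "x \<in> inf_pt i"
  then obtain e where x: "x = e *s w i" by (auto simp: inf_pt_def span_1)
  then have "x = (e * p i) *s a + (e * r i) *s b"
    unfolding w_def by (simp add: vec.scale_right_distrib)
  moreover have "x \<in> L i" using L_mem[of 0 i e] x by simp
  ultimately show "x \<in> vec.span {a, b} \<inter> L i" unfolding span_2 by blast
qed

section \<open>Dual number coordinates from a double eigenvalue\<close>

context four_lines
begin

text \<open>N = M - \<mu> is nonzero with square 0. Letting \<epsilon> act as N on both copies of
  the plane makes V a free R-module on (y, 0) and (0, y), for any y that is independent of n = N y;
  this n is then an eigenvector of M.\<close>

lemma frame:
  assumes tr: "m11 + m22 = 2 * \<mu>" and det': "(m11 - \<mu>) * (m22 - \<mu>) = m12 * m21"
    and nz: "m12 \<noteq> 0 \<or> m21 \<noteq> 0"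
  obtains n1 n2 a' b' p r s where
    "nilpotent_frame L (co n1 n2 0 0) a' (co 0 0 n1 n2) b' p r s i1 i2 i3 i4"
    "m11 * n1 + m12 * n2 = \<mu> * n1" "m21 * n1 + m22 * n2 = \<mu> * n2" "n1 \<noteq> 0 \<or> n2 \<noteq> 0"
proof -
  \<comment> \<open>The quantity is the determinant of N y and y. For y = (1, 0) it is
    \<open>- m21\<close> and for y = (0, 1) it is \<open>m12\<close>, so one of these two vectors
    works.\<close>
  obtain y1 y2 where y: "((m11 - \<mu>) * y1 + m12 * y2) * y2 - (m21 * y1 + (m22 - \<mu>) * y2) * y1 \<noteq> 0"
  proof (cases "m12 = 0")
    case True
    then show thesis using nz that[of 1 0] by simp
  next
    case False
    then show thesis using that[of 0 1] by simp
  qed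
  define n1 n2 where "n1 = (m11 - \<mu>) * y1 + m12 * y2" and "n2 = m21 * y1 + (m22 - \<mu>) * y2"
  have \<delta>: "n1 * y2 - n2 * y1 \<noteq> 0" using y by (simp add: n1_def n2_def)
  have m22: "m22 = 2 * \<mu> - m11" using tr by (simp add: algebra_simps)
  have m12m21: "m12 * m21 = - (m11 - \<mu>) * (m11 - \<mu>)"
    unfolding det'[symmetric] m22 by (simp add: algebra_simps)
  have "m11 * n1 + m12 * n2 - \<mu> * n1 = (m11 - \<mu>) * (m11 - \<mu>) * y1 + m12 * m21 * y1
      + m12 * (m11 + m22 - 2 * \<mu>) * y2"
    unfolding n1_def n2_def by (simp add: algebra_simps)
  also have "\<dots> = 0" unfolding m12m21 tr by (simp add: algebra_simps)
  finally have n1: "m11 * n1 + m12 * n2 = \<mu> * n1" by simp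
  have "m21 * n1 + m22 * n2 - \<mu> * n2 = m21 * (m11 + m22 - 2 * \<mu>) * y1 + (m12 * m21) * y2
      + (m22 - \<mu>) * (m22 - \<mu>) * y2"
    unfolding n1_def n2_def by (simp add: algebra_simps)
  also have "\<dots> = 0" unfolding m12m21 tr by (simp add: m22 algebra_simps)
  finally have n2: "m21 * n1 + m22 * n2 = \<mu> * n2" by simp
  have my: "m11 * y1 + m12 * y2 = \<mu> * y1 + n1" "m21 * y1 + m22 * y2 = \<mu> * y2 + n2"
    by (simp_all add: n1_def n2_def algebra_simps)
  \<comment> \<open>The determinants of M and M - 1 are \<mu> squared and (\<mu> - 1) squared; both
    are nonzero by skewness.\<close>
  have "m11 * m22 - m12 * m21 = \<mu> * \<mu>" unfolding m12m21 m22 by (simp add: algebra_simps)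
  then have \<mu>0: "\<mu> \<noteq> 0" using det by auto
  have "(m11 - 1) * (m22 - 1) - m12 * m21 = (\<mu> - 1) * (\<mu> - 1)"
    unfolding m12m21 m22 by (simp add: algebra_simps)
  then have \<mu>1: "\<mu> \<noteq> 1" using det1 by auto
  \<comment> \<open>These encode (1, 0), (0, 1), (1, 1) and (1, \<mu> + \<epsilon>) for i1, i2, i3
    and i4. The last one comes from M y = \<mu> y + n.\<close>
  define p r s where "p = (\<lambda>i. if i = i2 then 0 else 1 :: 'a)"
    and "r = (\<lambda>i. if i = i1 then 0 else if i = i4 then \<mu> else 1)"
    and "s = (\<lambda>i. if i = i4 then 1 else 0 :: 'a)"
  have d: "i1 \<noteq> i2" "i1 \<noteq> i3" "i1 \<noteq> i4" "i2 \<noteq> i3" "i2 \<noteq> i4" "i3 \<noteq> i4"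
    "i2 \<noteq> i1" "i3 \<noteq> i1" "i4 \<noteq> i1" "i3 \<noteq> i2" "i4 \<noteq> i2" "i4 \<noteq> i3"
    using distinct by auto
  note prs = p_def r_def s_def d
  let ?a = "co n1 n2 0 0" and ?a' = "co y1 y2 0 0" and ?b = "co 0 0 n1 n2" and ?b' = "co 0 0 y1 y2"
  have "nilpotent_frame L ?a ?a' ?b ?b' p r s i1 i2 i3 i4"
  proof
    show "indep4 ?a ?a' ?b ?b'"
      unfolding indep4_def co_scale co_add co_eq_0_iff
    proof (intro allI impI)
      fix c d e f
      assume *: "c * n1 + d * y1 + e * 0 + f * 0 = 0 \<and> c * n2 + d * y2 + e * 0 + f * 0 = 0 \<and>
        c * 0 + d * 0 + e * n1 + f * y1 = 0 \<and> c * 0 + d * 0 + e * n2 + f * y2 = 0"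
      have lin: "g = 0 \<and> h = 0" if "g * n1 + h * y1 = 0" "g * n2 + h * y2 = 0" for g h
      proof -
        have "g * (n1 * y2 - n2 * y1) = (g * n1 + h * y1) * y2 - (g * n2 + h * y2) * y1"
          "h * (n1 * y2 - n2 * y1) = (g * n2 + h * y2) * n1 - (g * n1 + h * y1) * n2"
          by (simp_all add: algebra_simps)
        then show ?thesis using that \<delta> by simp
      qed
      show "c = 0 \<and> d = 0 \<and> e = 0 \<and> f = 0"
        using lin[of c d] lin[of e f] * by simp
    qed
    have \<delta>': "y1 * n2 - y2 * n1 \<noteq> 0" using \<delta> by (simp add: algebra_simps)
    show "L i = vec.span {p i *s ?a' + r i *s ?b' + s i *s ?b, p i *s ?a + r i *s ?b}" for i
    proof -
      consider "i = i1" | "i = i2" | "i = i3" | "i = i4" using index_cases by blast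
      then show ?thesis
      proof cases
        case 1
        have "y1 *s e1 + y2 *s e2 = p i *s ?a' + r i *s ?b' + s i *s ?b"
          "n1 *s e1 + n2 *s e2 = p i *s ?a + r i *s ?b"
          by (simp_all add: 1 prs co_def)
        then show ?thesis using span_2_change[OF \<delta>', of e1 e2] by (simp add: 1 L1)
      next
        case 2
        have "y1 *s e3 + y2 *s e4 = p i *s ?a' + r i *s ?b' + s i *s ?b"
          "n1 *s e3 + n2 *s e4 = p i *s ?a + r i *s ?b"
          by (simp_all add: 2 prs co_def)
        then show ?thesis using span_2_change[OF \<delta>', of e3 e4] by (simp add: 2 L2)
      next
        case 3
        have "y1 *s (e1 + e3) + y2 *s (e2 + e4) = p i *s ?a' + r i *s ?b' + s i *s ?b"
          "n1 *s (e1 + e3) + n2 *s (e2 + e4) = p i *s ?a + r i *s ?b"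
          by (simp_all add: 3 prs co_def vec.scale_right_distrib algebra_simps)
        then show ?thesis using span_2_change[OF \<delta>', of "e1 + e3" "e2 + e4"] by (simp add: 3 L3)
      next
        case 4
        let ?k = "e1 + (m11 *s e3 + m21 *s e4)" and ?l = "e2 + (m12 *s e3 + m22 *s e4)"
        have kl: "s *s ?k + t *s ?l = co s t (m11 * s + m12 * t) (m21 * s + m22 * t)" for s t
          by (simp add: co_def vec.scale_right_distrib vec.scale_left_distrib algebra_simps)
        have "y1 *s ?k + y2 *s ?l = p i *s ?a' + r i *s ?b' + s i *s ?b"
          "n1 *s ?k + n2 *s ?l = p i *s ?a + r i *s ?b"
          unfolding kl my n1 n2 co_scale co_add by (simp_all add: 4 prs)
        then show ?thesis using span_2_change[OF \<delta>', of ?k ?l] by (simp only: 4 L4)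
      qed
    qed
    show "p i * r j - p j * r i \<noteq> 0" if "i \<noteq> j" for i j
      using that index_cases[of i] index_cases[of j] \<mu>0 \<mu>1 by (auto simp: prs)
    show "distinct [i1, i2, i3, i4]" by (rule distinct)
    show "(p i1 * s i3 - p i3 * s i1) / (p i1 * r i3 - p i3 * r i1)
      - (p i2 * s i3 - p i3 * s i2) / (p i2 * r i3 - p i3 * r i2)
      + (p i2 * s i4 - p i4 * s i2) / (p i2 * r i4 - p i4 * r i2)
      - (p i1 * s i4 - p i4 * s i1) / (p i1 * r i4 - p i4 * r i1) \<noteq> 0"
      using \<mu>0 by (simp add: prs)
  qed
  moreover have "n1 \<noteq> 0 \<or> n2 \<noteq> 0" using \<delta> by auto
  ultimately show thesis using that n1 n2 by blast
qed

text \<open>An off-diagonal entry times the determinant of two eigenvectors with the same eigenvalue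
  is 0, so the eigenvectors are proportional. Hence the T obtained from the quadric agrees with the
  one read off from the frame.\<close>

lemma eigenvector_unique:
  assumes v: "v1 \<noteq> 0 \<or> v2 \<noteq> 0" "m11 * v1 + m12 * v2 = \<mu> * v1" "m21 * v1 + m22 * v2 = \<mu> * v2"
    and n: "n1 \<noteq> 0 \<or> n2 \<noteq> 0" "m11 * n1 + m12 * n2 = \<mu> * n1" "m21 * n1 + m22 * n2 = \<mu> * n2"
    and nz: "m12 \<noteq> 0 \<or> m21 \<noteq> 0"
  shows "vec.span {co v1 v2 0 0, co 0 0 v1 v2} = vec.span {co n1 n2 0 0, co 0 0 n1 n2}"
proof -
  have "m12 * (v1 * n2 - v2 * n1) = v1 * (m11 * n1 + m12 * n2) - n1 * (m11 * v1 + m12 * v2)"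
    by (simp add: algebra_simps)
  also have "\<dots> = 0" unfolding v n by (simp add: algebra_simps)
  finally have 1: "m12 * (v1 * n2 - v2 * n1) = 0" .
  have "m21 * (v1 * n2 - v2 * n1) = n2 * (m21 * v1 + m22 * v2) - v2 * (m21 * n1 + m22 * n2)"
    by (simp add: algebra_simps)
  also have "\<dots> = 0" unfolding v n by (simp add: algebra_simps)
  finally have "m21 * (v1 * n2 - v2 * n1) = 0" .
  then have eq: "v1 * n2 = v2 * n1" using 1 nz by auto
  obtain c where c: "n1 = c * v1" "n2 = c * v2"
  proof (cases "v1 = 0")
    case True
    then show thesis using that[of "n2 / v2"] v(1) eq by auto
  next
    case False
    then show thesis using that[of "n1 / v1"] eq by (simp add: field_simps)
  qed
  then have "c * c - 0 * 0 \<noteq> 0" using n(1) by auto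
  from span_2_change[OF this, of "co v1 v2 0 0" "co 0 0 v1 v2"] show ?thesis
    unfolding co_scale co_add c by simp
qed

end

section \<open>Base change to the algebraic closure\<close>

definition vec_to_ac :: "'a::field ^ 4 \<Rightarrow> 'a alg_closure ^ 4" where
  "vec_to_ac x = (\<chi> m. to_ac (x $ m))"

lemma vec_to_ac_0 [simp]: "vec_to_ac 0 = 0"
  and vec_to_ac_add: "vec_to_ac (x + y) = vec_to_ac x + vec_to_ac y"
  and vec_to_ac_diff: "vec_to_ac (x - y) = vec_to_ac x - vec_to_ac y"
  and vec_to_ac_scale: "vec_to_ac (c *s x) = to_ac c *s vec_to_ac x"
  and vec_to_ac_eq_iff [simp]: "vec_to_ac x = vec_to_ac y \<longleftrightarrow> x = y"
  by (simp_all add: vec_to_ac_def vec_eq_iff)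

lemma vec_to_ac_eq_0_iff [simp]: "vec_to_ac x = 0 \<longleftrightarrow> x = 0"
  by (simp add: vec_to_ac_def vec_eq_iff)

lemma base_change_eq: "base_change U = vec.span (vec_to_ac ` U)"
  by (simp add: base_change_def vec_to_ac_def)

lemma base_change_span: "base_change (vec.span B) = vec.span (vec_to_ac ` B)"
proof
  have "vec_to_ac x \<in> vec.span (vec_to_ac ` B)" if "x \<in> vec.span B" for x
    using that
  proof (induction rule: vec.span_induct_alt)
    case base
    show ?case by (simp add: vec.span_zero)
  next
    case (step c x y)
    then show ?case
      unfolding vec_to_ac_add vec_to_ac_scale
      by (intro vec.span_add vec.span_scale) (auto intro: vec.span_base)
  qed
  then show "base_change (vec.span B) \<subseteq> vec.span (vec_to_ac ` B)"
    unfolding base_change_eq by (intro vec.span_minimal) auto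
  show "vec.span (vec_to_ac ` B) \<subseteq> base_change (vec.span B)"
    unfolding base_change_eq by (intro vec.span_mono image_mono) (auto intro: vec.span_base)
qed

lemma base_change_UNIV: "base_change UNIV = UNIV"
proof -
  have "axis i 1 = vec_to_ac (axis i 1)" for i :: 4
    by (simp add: vec_to_ac_def vec_eq_iff axis_def)
  then have "cart_basis \<subseteq> range vec_to_ac"
    unfolding cart_basis_def by blast
  then have "vec.span cart_basis \<subseteq> base_change UNIV"
    unfolding base_change_eq by (rule vec.span_mono)
  then show ?thesis by (simp add: vec.span_Basis top.extremum_unique)
qed

text \<open>For four vectors in dimension four, independence amounts to spanning, and spanning
  visibly survives base change.\<close>

lemma indep4_vec_to_ac:
  assumes "indep4 x y z u"
  shows "indep4 (vec_to_ac x) (vec_to_ac y) (vec_to_ac z) (vec_to_ac u)"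
proof (rule span_UNIV_indep4)
  have "vec.span {vec_to_ac x, vec_to_ac y, vec_to_ac z, vec_to_ac u} = base_change (vec.span {x, y, z, u})"
    by (simp add: base_change_span)
  then show "vec.span {vec_to_ac x, vec_to_ac y, vec_to_ac z, vec_to_ac u} = UNIV"
    by (simp add: indep4_span_UNIV[OF assms] base_change_UNIV)
qed

lemma four_lines_base_change:
  assumes "four_lines L i1 i2 i3 i4 e1 e2 e3 e4 m11 m12 m21 m22"
  shows "four_lines (\<lambda>i. base_change (L i)) i1 i2 i3 i4
    (vec_to_ac e1) (vec_to_ac e2) (vec_to_ac e3) (vec_to_ac e4)
    (to_ac m11) (to_ac m12) (to_ac m21) (to_ac m22)"
proof -
  interpret four_lines L i1 i2 i3 i4 e1 e2 e3 e4 m11 m12 m21 m22 by fact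
  have "to_ac (m11 * m22 - m12 * m21) \<noteq> 0" "to_ac ((m11 - 1) * (m22 - 1) - m12 * m21) \<noteq> 0"
    unfolding to_ac_eq_0_iff by (rule det det1)+
  then show ?thesis
    using distinct indep4_vec_to_ac[OF indep]
    by unfold_locales (simp_all add: L1 L2 L3 L4 base_change_span vec_to_ac_add vec_to_ac_scale)
qed

lemma nilpotent_frame_base_change:
  assumes "nilpotent_frame L a a' b b' p r s i1 i2 i3 i4"
  shows "nilpotent_frame (\<lambda>i. base_change (L i)) (vec_to_ac a) (vec_to_ac a') (vec_to_ac b) (vec_to_ac b')
    (\<lambda>i. to_ac (p i)) (\<lambda>i. to_ac (r i)) (\<lambda>i. to_ac (s i)) i1 i2 i3 i4"
proof -
  interpret nilpotent_frame L a a' b b' p r s i1 i2 i3 i4 by fact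
  show ?thesis
  proof
    show "indep4 (vec_to_ac a) (vec_to_ac a') (vec_to_ac b) (vec_to_ac b')"
      by (rule indep4_vec_to_ac[OF indep])
    show "base_change (L i) = vec.span {to_ac (p i) *s vec_to_ac a' + to_ac (r i) *s vec_to_ac b'
        + to_ac (s i) *s vec_to_ac b, to_ac (p i) *s vec_to_ac a + to_ac (r i) *s vec_to_ac b}" for i
      unfolding L_eq[of i] base_change_span by (simp add: vec_to_ac_add vec_to_ac_scale)
    show "to_ac (p i) * to_ac (r j) - to_ac (p j) * to_ac (r i) \<noteq> 0" if "i \<noteq> j" for i j
      using cross[OF that] by (simp flip: to_ac_mult to_ac_diff)
    show "distinct [i1, i2, i3, i4]" by (rule distinct)
    show "(to_ac (p i1) * to_ac (s i3) - to_ac (p i3) * to_ac (s i1)) / (to_ac (p i1) * to_ac (r i3) - to_ac (p i3) * to_ac (r i1))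
      - (to_ac (p i2) * to_ac (s i3) - to_ac (p i3) * to_ac (s i2)) / (to_ac (p i2) * to_ac (r i3) - to_ac (p i3) * to_ac (r i2))
      + (to_ac (p i2) * to_ac (s i4) - to_ac (p i4) * to_ac (s i2)) / (to_ac (p i2) * to_ac (r i4) - to_ac (p i4) * to_ac (r i2))
      - (to_ac (p i1) * to_ac (s i4) - to_ac (p i4) * to_ac (s i1)) / (to_ac (p i1) * to_ac (r i4) - to_ac (p i4) * to_ac (r i1)) \<noteq> 0"
      using cross_ratio by (simp only: to_ac_eq_0_iff flip: to_ac_mult to_ac_diff to_ac_add to_ac_divide) simp
  qed
qed

text \<open>If the base changes of x and y are proportional, the factor is a quotient of coordinates
  of x and y and therefore already lies in the base field.\<close>

lemma base_change_point_inject: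
  assumes "proj_point q" "proj_point q'" "base_change q = base_change q'"
  shows "q = (q' :: ('a::field ^ 4) set)"
proof -
  obtain x y where x: "x \<noteq> 0" "q = vec.span {x}" and y: "y \<noteq> 0" "q' = vec.span {y}"
    using assms by (auto simp: proj_point_iff)
  have "vec_to_ac x \<in> vec.span {vec_to_ac y}"
    using assms(3) vec.span_base[of "vec_to_ac x" "{vec_to_ac x}"] by (simp add: x y base_change_span)
  then obtain c where c: "vec_to_ac x = c *s vec_to_ac y" by (auto simp: span_1)
  obtain m where m: "y $ m \<noteq> 0" using y(1) by (auto simp: vec_eq_iff)
  have "to_ac (x $ m) = c * to_ac (y $ m)"
    using c by (simp add: vec_to_ac_def vec_eq_iff)
  then have "c = to_ac (x $ m / y $ m)" using m by (simp add: field_simps)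
  then have "vec_to_ac x = vec_to_ac ((x $ m / y $ m) *s y)" unfolding vec_to_ac_scale using c by simp
  then have eq: "x = (x $ m / y $ m) *s y" by (simp only: vec_to_ac_eq_iff)
  then have "x $ m / y $ m \<noteq> 0" using x(1) by auto
  then show ?thesis using span_scale_1[of "x $ m / y $ m" y] eq x(2) y(2) by metis
qed

lemma base_change_points_on:
  assumes "q \<in> points_on U" shows "base_change q \<in> points_on (base_change U)"
proof -
  obtain x where x: "x \<noteq> 0" "q = vec.span {x}" and "q \<subseteq> U"
    using assms by (auto simp: points_on_def proj_point_iff)
  then have "base_change q \<subseteq> base_change U"
    unfolding base_change_eq by (intro vec.span_mono image_mono)
  moreover have "proj_point (base_change q)"
    using x unfolding proj_point_iff by (intro exI[of _ "vec_to_ac x"]) (simp add: base_change_span)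
  ultimately show ?thesis by (simp add: points_on_def)
qed

section \<open>Comparison of the groupoids over K and over its closure\<close>

text \<open>A splitting x = y + z along \<open>L k\<close> and \<open>L l\<close> over the base
  field remains one over the closure, so both perspectivities are given by the same y.\<close>

lemma persp_base_change:
  assumes "skew_lines L" "j \<noteq> k" "j \<noteq> l" "k \<noteq> l"
    and bskew: "base_change (L k) \<inter> base_change (L l) = {0}"
    and q: "q \<in> points_on (L j)"
  shows "persp L j k l q \<in> points_on (L k)"
    "base_change (persp L j k l q) = persp (\<lambda>i. base_change (L i)) j k l (base_change q)"
proof -
  have line: "proj_line (L i)" for i using assms(1) by (simp add: skew_lines_def)
  note sub = line[THEN proj_lineD]
  have skew: "L k \<inter> L l = {0}" "L j \<inter> L l = {0}"
    using assms by (simp_all add: skew_lines_def)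
  have bsub: "vec.subspace (base_change (L i))" for i by (simp add: base_change_eq)
  have mem: "vec_to_ac x \<in> base_change (L i)" if "x \<in> L i" for x i
    unfolding base_change_eq using that by (intro vec.span_base) simp
  obtain x where x: "x \<noteq> 0" "q = vec.span {x}" and "q \<subseteq> L j"
    using q by (auto simp: points_on_def proj_point_iff)
  then have xL: "x \<in> L j" using vec.span_base[of x "{x}"] by blast
  obtain y z where y: "y \<in> L k" "z \<in> L l" "x = y + z"
    using line line skew(1) by (rule skew_lines_decompose)
  then have yz: "x - y = z" "vec_to_ac x - vec_to_ac y = vec_to_ac z"
    by (simp_all flip: vec_to_ac_diff)
  have "y \<noteq> 0" using eq_0_if_Int[OF skew(2) xL] x(1) y by auto
  have p: "persp L j k l q = vec.span {y}"
    unfolding x(2) using sub skew(1) xL x(1) y(1) y(2)[folded yz(1)] by (rule persp_span)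
  show "persp L j k l q \<in> points_on (L k)"
    unfolding p using \<open>y \<noteq> 0\<close> y(1) vec.span_minimal[of "{y}" "L k"] sub
    by (auto simp: points_on_def proj_point_iff)
  have "persp (\<lambda>i. base_change (L i)) j k l (vec.span {vec_to_ac x}) = vec.span {vec_to_ac y}"
  proof (rule persp_span)
    show "vec_to_ac x - vec_to_ac y \<in> base_change (L l)" unfolding yz by (rule mem[OF y(2)])
  qed (use bsub bskew mem xL y(1) x(1) in simp_all)
  then show "base_change (persp L j k l q) = persp (\<lambda>i. base_change (L i)) j k l (base_change q)"
    unfolding p unfolding x(2) by (simp add: base_change_span)
qed

lemma arrow_base_change:
  assumes "is_arrow L i j g" "skew_lines L"
    and bskew: "\<And>i j. i \<noteq> j \<Longrightarrow> base_change (L i) \<inter> base_change (L j) = {0}"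
  shows "\<exists>h. is_arrow (\<lambda>i. base_change (L i)) i j h \<and>
    (\<forall>q\<in>points_on (L i). g q \<in> points_on (L j) \<and> base_change (g q) = h (base_change q))"
  using assms(1)
proof induction
  case ident
  show ?case
    by (rule exI, rule conjI, rule is_arrow.ident) (simp add: base_change_points_on)
next
  case (comp j g k l)
  then obtain h where h: "is_arrow (\<lambda>i. base_change (L i)) i j h"
    "\<And>q. q \<in> points_on (L i) \<Longrightarrow> g q \<in> points_on (L j)"
    "\<And>q. q \<in> points_on (L i) \<Longrightarrow> base_change (g q) = h (base_change q)"
    by blast
  have "is_arrow (\<lambda>i. base_change (L i)) i k (compose (points_on (base_change (L i)))
      (persp (\<lambda>i. base_change (L i)) j k l) h)"
    using h(1) comp.hyps by (intro is_arrow.comp)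
  moreover have "persp L j k l (g q) \<in> points_on (L k) \<and>
      base_change (persp L j k l (g q)) = persp (\<lambda>i. base_change (L i)) j k l (h (base_change q))"
    if "q \<in> points_on (L i)" for q
    using persp_base_change[OF assms(2) comp.hyps(2-4) bskew[OF comp.hyps(4)] h(2)[OF that]] h(3)[OF that]
    by simp
  ultimately show ?case
    by (intro exI conjI ballI) (assumption, simp_all add: compose_eq base_change_points_on)
qed

lemma is_arrow_extensional: "is_arrow L i j g \<Longrightarrow> g \<in> extensional (points_on (L i))"
  by (induction rule: is_arrow.induct) (simp_all add: extensional_def compose_def)

text \<open>An arrow over K is recovered from the arrow with the same construction over the closure
  by restricting it to rational points, so the arrows over K lie in the image of \<open>?f\<close>.
  The arbitrary values of \<open>inv_into\<close> occur only for h that come from no arrow over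
  K.\<close>

lemma finite_arrows_base_change:
  assumes "skew_lines L" "\<And>i j. i \<noteq> j \<Longrightarrow> base_change (L i) \<inter> base_change (L j) = {0}"
    and fin: "finite (arrows (\<lambda>i. base_change (L i)) i j)"
  shows "finite (arrows L i j)"
proof -
  let ?f = "\<lambda>h. \<lambda>q\<in>points_on (L i). inv_into (points_on (L j)) base_change (h (base_change q))"
  have inj: "inj_on base_change (points_on (L j))"
    by (rule inj_onI, rule base_change_point_inject) (simp_all add: points_on_def)
  have "g \<in> ?f ` arrows (\<lambda>i. base_change (L i)) i j" if "g \<in> arrows L i j" for g
  proof -
    have g: "is_arrow L i j g" using that by (simp add: arrows_def)
    obtain h where h: "is_arrow (\<lambda>i. base_change (L i)) i j h"
      "\<And>q. q \<in> points_on (L i) \<Longrightarrow> g q \<in> points_on (L j) \<and> base_change (g q) = h (base_change q)"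
      using arrow_base_change[OF g assms(1,2)] by blast
    have "g = ?f h"
    proof (rule extensionalityI[OF is_arrow_extensional[OF g]])
      show "g q = ?f h q" if "q \<in> points_on (L i)" for q
        using h(2)[OF that] inv_into_f_f[OF inj, of "g q"] that by simp
    qed simp
    then show ?thesis using h(1) by (auto simp: arrows_def)
  qed
  then have "arrows L i j \<subseteq> ?f ` arrows (\<lambda>i. base_change (L i)) i j" by blast
  then show ?thesis using fin by (rule finite_subset[OF _ finite_imageI])
qed

section \<open>When the double eigenvalue is rational\<close>

lemma double_eq_0_imp_eq_0:
  fixes c :: "'a::field"
  assumes "CHAR('a) \<noteq> 2" "2 * c = 0" shows "c = 0"
proof (rule ccontr)
  assume "c \<noteq> 0"
  then have "of_nat 2 = (0 :: 'a)" using assms(2) by simp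
  then have "CHAR('a) dvd 2" by (simp only: of_nat_eq_0_iff_char_dvd)
  then have "CHAR('a) \<le> 2" "CHAR('a) \<noteq> 0" by (auto intro: dvd_imp_le gr0I)
  then have "CHAR('a) = 1" using assms(1) by linarith
  then show False by simp
qed

text \<open>Squaring is the Frobenius map: it is injective in characteristic 2, hence surjective on
  a finite field.\<close>

lemma finite_field_CHAR_2_sqrt:
  fixes x :: "'a::field"
  assumes "CHAR('a) = 2" "finite (UNIV :: 'a set)"
  obtains k where "k * k = x"
proof -
  have 2: "(2 :: 'a) = 0" using of_nat_CHAR[where 'a = 'a] assms(1) by simp
  have "inj (\<lambda>k :: 'a. k * k)"
  proof (rule injI)
    fix y z :: 'a assume "y * y = z * z"
    then have "(y - z) * (y - z) = 2 * (z * (z - y))" by (simp add: algebra_simps)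
    then have "(y - z) * (y - z) = 0" unfolding 2 by simp
    then show "y = z" by simp
  qed
  then have "surj (\<lambda>k :: 'a. k * k)" using assms(2) by (simp add: finite_UNIV_inj_surj)
  then show thesis using that by (metis surjD)
qed

text \<open>Outside characteristic 2, \<mu> is half the trace of M. In characteristic 2 the trace is
  0 and \<mu> is the unique square root of the determinant, which lies in K when K is
  finite.\<close>

lemma (in four_lines) eigenvalue_rational_if_CHAR:
  assumes tr: "to_ac m11 + to_ac m22 = 2 * \<mu>"
    and det': "(to_ac m11 - \<mu>) * (to_ac m22 - \<mu>) = to_ac m12 * to_ac m21"
    and char: "CHAR('a) \<noteq> 2 \<or> CHAR('a) = 2 \<and> finite (UNIV :: 'a set)"
  obtains k where "\<mu> = to_ac k"
proof (cases "CHAR('a) = 2")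
  case False
  then have "(2 :: 'a) \<noteq> 0" using double_eq_0_imp_eq_0[of "1 :: 'a"] by auto
  then have nz: "(2 :: 'a alg_closure) \<noteq> 0" using to_ac_eq_0_iff[of "2 :: 'a"] by simp
  have "2 * to_ac ((m11 + m22) / 2) = 2 * \<mu>"
    using tr nz by (simp add: field_simps)
  then have "\<mu> = to_ac ((m11 + m22) / 2)" using nz by simp
  then show thesis by (rule that)
next
  case True
  then have "finite (UNIV :: 'a set)" using char by simp
  then obtain k where k: "k * k = m11 * m22 - m12 * m21"
    using True finite_field_CHAR_2_sqrt by metis
  have 2: "(2 :: 'a alg_closure) = 0"
    using of_nat_CHAR[where 'a = "'a alg_closure"] True by simp
  have "to_ac k * to_ac k = to_ac m11 * to_ac m22 - to_ac m12 * to_ac m21"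
    using k by (simp flip: to_ac_mult to_ac_diff)
  also have "\<dots> = \<mu> * (to_ac m11 + to_ac m22) - \<mu> * \<mu>"
    unfolding det'[symmetric] by (simp add: algebra_simps)
  finally have "to_ac k * to_ac k = \<mu> * \<mu>" unfolding tr by (simp add: algebra_simps)
  then have "(to_ac k - \<mu>) * (to_ac k - \<mu>) = 2 * (\<mu> * (\<mu> - to_ac k))" by (simp add: algebra_simps)
  then have "(to_ac k - \<mu>) * (to_ac k - \<mu>) = 0" unfolding 2 by simp
  then show thesis using that[of k] by simp
qed

text \<open>A nonzero rational vector of T has the form (\<alpha> v, \<beta> v), and one of its
  halves is a nonzero rational multiple of v. Thus \<mu> is an eigenvalue of M with a rational
  eigenvector, and a quotient of coordinates expresses it in K.\<close>

lemma (in four_lines) eigenvalue_rational_if_defined_over_base: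
  assumes eigen: "to_ac m11 * v1 + to_ac m12 * v2 = \<mu> * v1" "to_ac m21 * v1 + to_ac m22 * v2 = \<mu> * v2"
    and T: "T = vec.span {v1 *s vec_to_ac e1 + v2 *s vec_to_ac e2, v1 *s vec_to_ac e3 + v2 *s vec_to_ac e4}"
    and "proj_line T" "defined_over_base T"
  obtains k where "\<mu> = to_ac k"
proof -
  note ind = indep4_vec_to_ac[OF indep]
  obtain U where U: "vec.subspace U" "T = base_change U"
    using assms(5) unfolding defined_over_base_def by blast
  have "\<not> U \<subseteq> {0}"
  proof
    assume "U \<subseteq> {0}"
    then have "vec_to_ac ` U \<subseteq> {0}" by auto
    then have "T \<subseteq> vec.span {0}" unfolding U base_change_eq by (rule vec.span_mono)
    then have "vec.dim T = 0" by simp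
    then show False using assms(4) by (simp add: proj_line_def del: vec.dim_eq_0)
  qed
  then obtain u where u: "u \<in> U" "u \<noteq> 0" by blast
  obtain x1 x2 x3 x4 where x: "u = co x1 x2 x3 x4" by (rule co_cases)
  have "vec_to_ac u \<in> T" unfolding U(2) base_change_eq using u by (intro vec.span_base) simp
  then obtain \<alpha> \<beta> where ab: "vec_to_ac u = \<alpha> *s (v1 *s vec_to_ac e1 + v2 *s vec_to_ac e2)
      + \<beta> *s (v1 *s vec_to_ac e3 + v2 *s vec_to_ac e4)"
    unfolding T span_2 by blast
  have "vec_to_ac u = to_ac x1 *s vec_to_ac e1 + to_ac x2 *s vec_to_ac e2
      + to_ac x3 *s vec_to_ac e3 + to_ac x4 *s vec_to_ac e4"
    unfolding x co_def by (simp only: vec_to_ac_add vec_to_ac_scale)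
  moreover have "vec_to_ac u = (\<alpha> * v1) *s vec_to_ac e1 + (\<alpha> * v2) *s vec_to_ac e2
      + (\<beta> * v1) *s vec_to_ac e3 + (\<beta> * v2) *s vec_to_ac e4"
    unfolding ab by (simp only: vec.scale_right_distrib vec.scale_scale add.assoc)
  ultimately have eqs: "to_ac x1 = \<alpha> * v1" "to_ac x2 = \<alpha> * v2" "to_ac x3 = \<beta> * v1" "to_ac x4 = \<beta> * v2"
    using indep4_eq_iff[OF ind] by metis+
  note eigenvalue = that
  have rat: thesis if y: "to_ac y1 = \<gamma> * v1" "to_ac y2 = \<gamma> * v2" "y1 \<noteq> 0 \<or> y2 \<noteq> 0" for y1 y2 \<gamma>
  proof -
    have "to_ac (m11 * y1 + m12 * y2) = \<gamma> * (to_ac m11 * v1 + to_ac m12 * v2)"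
      "to_ac (m21 * y1 + m22 * y2) = \<gamma> * (to_ac m21 * v1 + to_ac m22 * v2)"
      by (simp_all add: y algebra_simps)
    then have *: "to_ac (m11 * y1 + m12 * y2) = \<mu> * to_ac y1" "to_ac (m21 * y1 + m22 * y2) = \<mu> * to_ac y2"
      unfolding eigen y by (simp_all add: algebra_simps)
    show thesis
    proof (cases "y1 = 0")
      case True
      then have "\<mu> = to_ac ((m21 * y1 + m22 * y2) / y2)"
        unfolding to_ac_divide * using y(3) by simp
      then show thesis by (rule eigenvalue)
    next
      case False
      then have "\<mu> = to_ac ((m11 * y1 + m12 * y2) / y1)"
        unfolding to_ac_divide * by simp
      then show thesis by (rule eigenvalue)
    qed
  qed
  show thesis
  proof (cases "x1 = 0 \<and> x2 = 0")
    case True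
    then have "x3 \<noteq> 0 \<or> x4 \<noteq> 0" using u(2) x co_0 by auto
    then show thesis using rat eqs(3,4) by blast
  next
    case False
    then show thesis using rat eqs(1,2) by blast
  qed
qed

theorem proposition2p1p20:
  fixes L :: "4 \<Rightarrow> ('a::field ^ 4) set"
    and T :: "('a alg_closure ^ 4) set"
  assumes "skew_lines L"
    and "transversal_mult2 (\<lambda>i. base_change (L i)) T"
  shows
    "(CHAR('a) \<noteq> 2 \<or> (CHAR('a) = 2 \<and> finite (UNIV :: 'a set)) \<longrightarrow>
        defined_over_base T \<and> defined_over_base (T \<inter> base_change (L 4)))
     \<and>
     (defined_over_base T \<longrightarrow>
        (\<forall>i. embeds_in_additive_group (vertex_group L i) TYPE('a) \<and>
             comm_group (vertex_group L i) \<and>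
             (\<forall>p \<in> points_on (L i). \<not> base_change p \<subseteq> T \<longrightarrow> acts_faithfully_at L i p) \<and>
             (\<forall>p \<in> points_on (base_change (L i)). \<not> p \<subseteq> T \<longrightarrow>
                 acts_faithfully_at (\<lambda>j. base_change (L j)) i p)))
     \<and>
     (\<forall>i. (\<forall>p \<in> points_on (L i). \<not> base_change p \<subseteq> T \<longrightarrow>
              (infinite (carrier (vertex_group L i)) \<longleftrightarrow> CHAR('a) = 0) \<and>
              (infinite (groupoid_orbit L i p) \<longleftrightarrow> CHAR('a) = 0)) \<and>
          (\<forall>p \<in> points_on (base_change (L i)). \<not> p \<subseteq> T \<longrightarrow>
              (infinite (carrier (vertex_group (\<lambda>j. base_change (L j)) i)) \<longleftrightarrow> CHAR('a) = 0) \<and>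
              (infinite (groupoid_orbit (\<lambda>j. base_change (L j)) i p) \<longleftrightarrow> CHAR('a) = 0)))"
proof -
  let ?L = "\<lambda>i. base_change (L i)"
  have trans: "transversal ?L T"
    and no_quadric: "\<not> (\<exists>A. smooth_quadric A \<and> (\<forall>i. ?L i \<subseteq> quadric A))"
    using assms(2) by (simp_all add: transversal_mult2_def)
  obtain i1 i2 i3 A where i123: "i1 \<noteq> i2" "i1 \<noteq> i3" "i2 \<noteq> i3" and A: "smooth_quadric A"
      "?L i1 \<subseteq> quadric A" "?L i2 \<subseteq> quadric A" "?L i3 \<subseteq> quadric A"
      "\<And>i. ?L i \<subseteq> quadric A \<or> tangent_at A (?L i) (?L i \<inter> T)"
    using assms(2) unfolding transversal_mult2_def by blast
  \<comment> \<open>Multiplicity 2 supplies three indices in no particular position; the remaining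
    one takes the role of i4.\<close>
  have "card {i1, i2, i3} < card (UNIV :: 4 set)" using i123 by simp
  then have "{i1, i2, i3} \<noteq> UNIV" by (metis less_irrefl)
  then obtain i4 where "i4 \<notin> {i1, i2, i3}" by blast
  then have distinct: "distinct [i1, i2, i3, i4]" using i123 by auto
  obtain e1 e2 e3 e4 m11 m12 m21 m22 where K: "four_lines L i1 i2 i3 i4 e1 e2 e3 e4 m11 m12 m21 m22"
    using skew_lines_four_lines[OF assms(1) distinct] .
  interpret K: four_lines L i1 i2 i3 i4 e1 e2 e3 e4 m11 m12 m21 m22 by (rule K)
  interpret B: four_lines ?L i1 i2 i3 i4 "vec_to_ac e1" "vec_to_ac e2" "vec_to_ac e3" "vec_to_ac e4"
    "to_ac m11" "to_ac m12" "to_ac m21" "to_ac m22"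
    by (rule four_lines_base_change[OF K])
  \<comment> \<open>Otherwise one smooth quadric would contain all four lines. Hence the alternative
    that holds for \<open>L i4\<close> is tangency.\<close>
  have n4: "\<not> ?L i4 \<subseteq> quadric A"
  proof
    assume "?L i4 \<subseteq> quadric A"
    then have "?L i \<subseteq> quadric A" for i using A(2-4) K.index_cases[of i] by auto
    then show False using no_quadric A(1) by blast
  qed
  obtain v1 v2 \<mu> where v: "v1 \<noteq> 0 \<or> v2 \<noteq> 0"
    and eigen: "to_ac m11 * v1 + to_ac m12 * v2 = \<mu> * v1" "to_ac m21 * v1 + to_ac m22 * v2 = \<mu> * v2"
    and T: "T = vec.span {B.co v1 v2 0 0, B.co 0 0 v1 v2}"
    and tr: "to_ac m11 + to_ac m22 = 2 * \<mu>"
    and det: "(to_ac m11 - \<mu>) * (to_ac m22 - \<mu>) = to_ac m12 * to_ac m21"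
    and nz: "to_ac m12 \<noteq> 0 \<or> to_ac m21 \<noteq> 0"
  proof (rule B.multiplicity_2_eigenvalue[OF _ A(2-4) n4 _ trans])
    show "\<not> (quad_form A x = 0 \<and> quad_grad A x = 0)" if "x \<noteq> 0" for x
      using A(1) that by (auto simp: smooth_quadric_def)
    show "polar A x y = 0" if "x \<in> ?L i4 \<inter> T" "y \<in> ?L i4" for x y
      using A(5)[of i4] n4 that unfolding tangent_at_def polar_def by blast
  qed blast
  \<comment> \<open>Only the eigenvalue is assumed rational. The frame produces its own rational
    eigenvector, and uniqueness of the eigenvector identifies the resulting transversal with
    T.\<close>
  have rational_frame: "\<exists>a a' b b' p r s. nilpotent_frame L a a' b b' p r s i1 i2 i3 i4
      \<and> T = vec.span {vec_to_ac a, vec_to_ac b}" if "\<mu> = to_ac k" for k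
  proof -
    have "to_ac (m11 + m22) = to_ac (2 * k)" "to_ac ((m11 - k) * (m22 - k)) = to_ac (m12 * m21)"
      using tr det that by simp_all
    then have "m11 + m22 = 2 * k" "(m11 - k) * (m22 - k) = m12 * m21" "m12 \<noteq> 0 \<or> m21 \<noteq> 0"
      using nz by (simp_all only: to_ac_eq_iff to_ac_eq_0_iff)
    then obtain n1 n2 a' b' p r s where
      F: "nilpotent_frame L (K.co n1 n2 0 0) a' (K.co 0 0 n1 n2) b' p r s i1 i2 i3 i4"
      and n: "m11 * n1 + m12 * n2 = k * n1" "m21 * n1 + m22 * n2 = k * n2" "n1 \<noteq> 0 \<or> n2 \<noteq> 0"
      by (rule K.frame)
    have "to_ac m11 * to_ac n1 + to_ac m12 * to_ac n2 = \<mu> * to_ac n1"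
        "to_ac m21 * to_ac n1 + to_ac m22 * to_ac n2 = \<mu> * to_ac n2" "to_ac n1 \<noteq> 0 \<or> to_ac n2 \<noteq> 0"
      using n unfolding that by (simp_all flip: to_ac_mult to_ac_add)
    then have "T = vec.span {B.co (to_ac n1) (to_ac n2) 0 0, B.co 0 0 (to_ac n1) (to_ac n2)}"
      unfolding T using v eigen nz by (intro B.eigenvector_unique)
    moreover have "vec_to_ac (K.co c d e f) = B.co (to_ac c) (to_ac d) (to_ac e) (to_ac f)" for c d e f
      unfolding K.co_def B.co_def by (simp add: vec_to_ac_add vec_to_ac_scale)
    ultimately show ?thesis using F by (metis to_ac_0)
  qed
  have rational: "\<exists>k. \<mu> = to_ac k" if "defined_over_base T"
  proof -
    have "proj_line T" using trans by (simp add: transversal_def)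
    moreover have "T = vec.span {v1 *s vec_to_ac e1 + v2 *s vec_to_ac e2, v1 *s vec_to_ac e3 + v2 *s vec_to_ac e4}"
      unfolding T B.co_def by simp
    ultimately show ?thesis using K.eigenvalue_rational_if_defined_over_base[OF eigen] that by metis
  qed
  have char_rational: "\<exists>k. \<mu> = to_ac k" if "CHAR('a) \<noteq> 2 \<or> CHAR('a) = 2 \<and> finite (UNIV :: 'a set)"
    using K.eigenvalue_rational_if_CHAR[OF tr det that] by metis
  \<comment> \<open>Over the closure \<mu> is always available, so this second frame exists in every
    case.\<close>
  obtain n1 n2 a' b' p r s where
    FB: "nilpotent_frame ?L (B.co n1 n2 0 0) a' (B.co 0 0 n1 n2) b' p r s i1 i2 i3 i4"
    and n: "to_ac m11 * n1 + to_ac m12 * n2 = \<mu> * n1" "to_ac m21 * n1 + to_ac m22 * n2 = \<mu> * n2"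
      "n1 \<noteq> 0 \<or> n2 \<noteq> 0"
    using tr det nz by (rule B.frame)
  have TB: "T = vec.span {B.co n1 n2 0 0, B.co 0 0 n1 n2}"
    unfolding T using v eigen n nz by (intro B.eigenvector_unique)
  interpret FB: nilpotent_frame ?L "B.co n1 n2 0 0" a' "B.co 0 0 n1 n2" b' p r s i1 i2 i3 i4 by (rule FB)
  have off_T: "q \<noteq> FB.inf_pt i" if "\<not> q \<subseteq> T" for q i
    using that FB.span_Int_L[of i] unfolding TB by blast

  have a: "defined_over_base T \<and> defined_over_base (T \<inter> base_change (L i))" if k: "\<mu> = to_ac k" for k i
  proof -
    obtain a a' b b' p r s where F: "nilpotent_frame L a a' b b' p r s i1 i2 i3 i4"
      and TF: "T = vec.span {vec_to_ac a, vec_to_ac b}"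
      using rational_frame[OF k] by blast
    interpret F: nilpotent_frame L a a' b b' p r s i1 i2 i3 i4 by (rule F)
    interpret FB': nilpotent_frame ?L "vec_to_ac a" "vec_to_ac a'" "vec_to_ac b" "vec_to_ac b'"
      "\<lambda>i. to_ac (p i)" "\<lambda>i. to_ac (r i)" "\<lambda>i. to_ac (s i)" i1 i2 i3 i4
      by (rule nilpotent_frame_base_change[OF F])
    have "T = base_change (vec.span {a, b})" unfolding TF by (simp add: base_change_span)
    \<comment> \<open>The point of T on \<open>L i\<close> is spanned by \<epsilon> e_i, which is a
      rational vector.\<close>
    moreover have "FB'.inf_pt i = base_change (F.inf_pt i)"
      unfolding FB'.inf_pt_def F.inf_pt_def FB'.w_def F.w_def
      by (simp add: base_change_span vec_to_ac_add vec_to_ac_scale)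
    then have "T \<inter> base_change (L i) = base_change (F.inf_pt i)"
      using FB'.span_Int_L[of i] unfolding TF by simp
    moreover have "vec.subspace (F.inf_pt i)" unfolding F.inf_pt_def by simp
    ultimately show ?thesis unfolding defined_over_base_def by (metis vec.subspace_span)
  qed

  have b: "embeds_in_additive_group (vertex_group L i) TYPE('a) \<and> comm_group (vertex_group L i) \<and>
      (\<forall>q \<in> points_on (L i). \<not> base_change q \<subseteq> T \<longrightarrow> acts_faithfully_at L i q) \<and>
      (infinite (carrier (vertex_group L i)) \<longleftrightarrow> CHAR('a) = 0) \<and>
      (\<forall>q \<in> points_on (L i). \<not> base_change q \<subseteq> T \<longrightarrow> (infinite (groupoid_orbit L i q) \<longleftrightarrow> CHAR('a) = 0))"
    if k: "\<mu> = to_ac k" for k i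
  proof -
    obtain a a' b b' p r s where F: "nilpotent_frame L a a' b b' p r s i1 i2 i3 i4"
      and TF: "T = vec.span {vec_to_ac a, vec_to_ac b}"
      using rational_frame[OF k] by blast
    interpret F: nilpotent_frame L a a' b b' p r s i1 i2 i3 i4 by (rule F)
    have off: "q \<noteq> F.inf_pt i" if "\<not> base_change q \<subseteq> T" for q
    proof
      assume q: "q = F.inf_pt i"
      have "vec_to_ac ` F.inf_pt i \<subseteq> vec_to_ac ` vec.span {a, b}" using F.span_Int_L[of i] by blast
      then have "base_change q \<subseteq> base_change (vec.span {a, b})"
        unfolding q base_change_eq by (rule vec.span_mono)
      then show False using that unfolding TF by (simp add: base_change_span)
    qed
    show ?thesis
      using F.embeds_vertex_group F.comm_group_vertex_group F.acts_faithfully F.infinite_vertex_group_iff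
        F.infinite_orbit_iff off by blast
  qed

  have c: "(infinite (carrier (vertex_group L i)) \<longleftrightarrow> CHAR('a) = 0) \<and>
      (infinite (groupoid_orbit L i q) \<longleftrightarrow> CHAR('a) = 0)"
    if q: "q \<in> points_on (L i)" "\<not> base_change q \<subseteq> T" for q i
  proof (cases "\<exists>k. \<mu> = to_ac k")
    case True
    then show ?thesis using b q by blast
  next
    \<comment> \<open>With \<mu> outside K there is no frame over K. The characteristic cannot be 0,
      so finiteness has to be shown; it holds over the closure and descends along base change of
      arrows.\<close>
    case False
    have char: "CHAR('a) \<noteq> 0"
    proof
      assume "CHAR('a) = 0"
      then have "CHAR('a) \<noteq> 2" by simp
      then show False using char_rational False by blast
    qed
    then have fin': "finite (arrows ?L i j)" for j
      using FB.finite_shift[of i j] by (simp add: FB.arrows_eq)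
    have fin: "finite (arrows L i j)" for j
      by (rule finite_arrows_base_change[OF assms(1) FB.skew fin'])
    have "groupoid_orbit L i q = (\<Union>j. (\<lambda>g. g q) ` arrows L i j)"
      unfolding groupoid_orbit_def by blast
    then have "finite (groupoid_orbit L i q)" using fin by simp
    moreover have "finite (carrier (vertex_group L i))" using fin by (simp add: vertex_group_def)
    ultimately show ?thesis using char by blast
  qed

  \<comment> \<open>For points over the closure the frame there applies directly, since the closure
    has the same characteristic as K.\<close>
  have bar: "acts_faithfully_at ?L i q" "infinite (carrier (vertex_group ?L i)) \<longleftrightarrow> CHAR('a) = 0"
      "infinite (groupoid_orbit ?L i q) \<longleftrightarrow> CHAR('a) = 0"
    if "q \<in> points_on (base_change (L i))" "\<not> q \<subseteq> T" for q i
    using FB.acts_faithfully[OF that(1) off_T[OF that(2)]] FB.infinite_vertex_group_iff[of i]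
      FB.infinite_orbit_iff[OF that(1) off_T[OF that(2)]] by simp_all

  show ?thesis
  proof (intro conjI, goal_cases)
    case 1
    show ?case using a char_rational by blast
  next
    case 2
    show ?case using rational b bar(1) by blast
  next
    case 3
    show ?case using c bar(2,3) by blast
  qed
qed

end
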